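(* Let $A(x)=(1+x)\log(1+x)+(1-x)\log(1-x)$. Let $\Gamma$ be a countable group with a proper left-invariant distance and let $\mu\ne\delta_e$ be a symmetric probability measure on $\Gamma$ with finite second moment and finite entropy. Then $$A\left(\frac{\ell}{M_2(\mu)}\right)+2\,|\log\rho|\le h .$$
   Context: A distance on $\Gamma$ is proper if all balls are finite; $|g|=\operatorname{dist}(g,e)$. The measure $\mu$ is symmetric if $\mu(g)=\mu(g^{-1})$ for all $g$; it has finite entropy if $-\sum_g\mu(g)\log\mu(g)<\infty$, and finite second moment if $M_2(\mu):=\left(\sum_g|g|^2\mu(g)\right)^{1/2}<\infty$. With $\mu^{*n}$ the $n$-fold convolution of $\mu$, the asymptotic entropy, spectral radius and drift are $$h=\lim_n-\frac1n\sum_g\mu^{*n}(g)\log\mu^{*n}(g),\qquad \rho=\limsup_n\sqrt[n]{\mu^{*n}(e)},\qquad \ell=\lim_n\frac1n\sum_g|g|\,\mu^{*n}(g).$$ By convention $0\log0=0$. *)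

theory Defs
  imports "HOL-Probability.Probability" "HOL-Algebra.Group"
begin

text \<open>
  A probability measure on a countable group \<open>G\<close> is a \<open>pmf\<close> whose support lies in
  \<open>carrier G\<close>; Dirac measure at \<open>e\<close> is \<open>return_pmf \<one>\<^bsub>G\<^esub>\<close>.
\<close>

definition left_invariant :: "('a, 'b) monoid_scheme \<Rightarrow> ('a \<Rightarrow> 'a \<Rightarrow> real) \<Rightarrow> bool" where
  "left_invariant G d \<longleftrightarrow>
     (\<forall>g\<in>carrier G. \<forall>x\<in>carrier G. \<forall>y\<in>carrier G. d (g \<otimes>\<^bsub>G\<^esub> x) (g \<otimes>\<^bsub>G\<^esub> y) = d x y)"

definition proper_distance :: "('a, 'b) monoid_scheme \<Rightarrow> ('a \<Rightarrow> 'a \<Rightarrow> real) \<Rightarrow> bool" where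
  "proper_distance G d \<longleftrightarrow>
     (\<forall>x\<in>carrier G. \<forall>r. finite (Metric_space.mball (carrier G) d x r))"

definition symmetric_pmf :: "('a, 'b) monoid_scheme \<Rightarrow> 'a pmf \<Rightarrow> bool" where
  "symmetric_pmf G \<mu> \<longleftrightarrow> (\<forall>g\<in>carrier G. pmf \<mu> g = pmf \<mu> (inv\<^bsub>G\<^esub> g))"

fun conv_pow :: "('a, 'b) monoid_scheme \<Rightarrow> 'a pmf \<Rightarrow> nat \<Rightarrow> 'a pmf" where
  "conv_pow G \<mu> 0 = return_pmf \<one>\<^bsub>G\<^esub>"
| "conv_pow G \<mu> (Suc n) = map_pmf (\<lambda>(x, y). x \<otimes>\<^bsub>G\<^esub> y) (pair_pmf (conv_pow G \<mu> n) \<mu>)"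

text \<open>
  The sums below are real-valued and so equal \<open>0\<close> when they diverge; finiteness is expressed
  separately by summability. The convention \<open>0 log 0 = 0\<close> holds automatically, since
  the factor \<open>0\<close> annihilates the value of \<open>ln\<close> at \<open>0\<close>.
\<close>

definition finite_entropy :: "('a, 'b) monoid_scheme \<Rightarrow> 'a pmf \<Rightarrow> bool" where
  "finite_entropy G \<mu> \<longleftrightarrow> (\<lambda>g. pmf \<mu> g * ln (pmf \<mu> g)) summable_on carrier G"

definition entropy_pmf :: "('a, 'b) monoid_scheme \<Rightarrow> 'a pmf \<Rightarrow> real" where
  "entropy_pmf G \<mu> = - (\<Sum>\<^sub>\<infinity>g\<in>carrier G. pmf \<mu> g * ln (pmf \<mu> g))"

definition finite_second_moment ::
    "('a, 'b) monoid_scheme \<Rightarrow> ('a \<Rightarrow> 'a \<Rightarrow> real) \<Rightarrow> 'a pmf \<Rightarrow> bool" where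
  "finite_second_moment G d \<mu> \<longleftrightarrow> (\<lambda>g. (d g \<one>\<^bsub>G\<^esub>)\<^sup>2 * pmf \<mu> g) summable_on carrier G"

definition M2 :: "('a, 'b) monoid_scheme \<Rightarrow> ('a \<Rightarrow> 'a \<Rightarrow> real) \<Rightarrow> 'a pmf \<Rightarrow> real" where
  "M2 G d \<mu> = sqrt (\<Sum>\<^sub>\<infinity>g\<in>carrier G. (d g \<one>\<^bsub>G\<^esub>)\<^sup>2 * pmf \<mu> g)"

definition asymptotic_entropy :: "('a, 'b) monoid_scheme \<Rightarrow> 'a pmf \<Rightarrow> real" where
  "asymptotic_entropy G \<mu> = lim (\<lambda>n. entropy_pmf G (conv_pow G \<mu> n) / real n)"

text \<open>The upper limit is taken in \<open>ereal\<close>; it lies in \<open>[0, 1]\<close>, so nothing is lost on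
  returning to \<open>real\<close>.\<close>

definition spectral_radius_pmf :: "('a, 'b) monoid_scheme \<Rightarrow> 'a pmf \<Rightarrow> real" where
  "spectral_radius_pmf G \<mu> =
     real_of_ereal (limsup (\<lambda>n. ereal (root n (pmf (conv_pow G \<mu> n) \<one>\<^bsub>G\<^esub>))))"

definition drift :: "('a, 'b) monoid_scheme \<Rightarrow> ('a \<Rightarrow> 'a \<Rightarrow> real) \<Rightarrow> 'a pmf \<Rightarrow> real" where
  "drift G d \<mu> =
     lim (\<lambda>n. (\<Sum>\<^sub>\<infinity>g\<in>carrier G. d g \<one>\<^bsub>G\<^esub> * pmf (conv_pow G \<mu> n) g) / real n)"

definition A :: "real \<Rightarrow> real" where
  "A x = (1 + x) * ln (1 + x) + (1 - x) * ln (1 - x)"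

end

theory Submission
  imports Defs "HOL-Real_Asymp.Real_Asymp"
begin

text \<open>
  Let \<open>P\<close> be the Markov operator of the walk. The inequality is the limit \<open>p \<longlonglongrightarrow> 0\<close> of an inequality
  for one probability measure: the law \<open>R\<close> of the walk at an independent geometric time of parameter
  \<open>p\<close>. As \<open>R\<close> is a multiple of a resolvent of \<open>P\<close> at the identity, it satisfies
  \<open>R = p \<delta>\<^sub>e + (1 - p) R * \<mu>\<close>. Hence along a random edge \<open>(g, g x)\<close>, where \<open>g\<close> has law \<open>R\<close> and \<open>x\<close> has law
  \<open>\<mu>\<close>, a function \<open>f\<close> grows on average by exactly \<open>p / (1 - p) * (E\<^sub>R f - f e)\<close>
  (\<open>resolvent_increment\<close>). For \<open>f = - ln R\<close> this is at most \<open>p / (1 - p)\<close> times the entropy of \<open>R\<close>,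
  which is asymptotically at most \<open>h\<close> (\<open>shannon_resolvent_le\<close>); for the length function it is at
  least the drift (\<open>drift_le_increment\<close>). Working with \<open>R\<close> instead of \<open>\<mu>\<^sup>n\<close> avoids any comparison
  between consecutive convolution powers.
  
  Because \<open>\<mu>\<close> is symmetric, reversing an edge multiplies its probability by \<open>r = R(g x) / R(g)\<close>
  (\<open>reversal\<close>). Put \<open>t = (1 - r) / (1 + r)\<close> and give each edge the symmetrised weight
  \<open>w = (1 + r) / 2\<close>, whose mean is \<open>1\<close>. The mean increment of \<open>f\<close> is then the mean of
  \<open>w t (f (g x) - f g)\<close>. For \<open>f = - ln R\<close> the increment is \<open>ln (1 + t) - ln (1 - t)\<close>, and the identity
  \<open>t (ln (1 + t) - ln (1 - t)) = A t - ln (1 - t\<^sup>2)\<close> splits the mean increment into two parts.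
  
  First, the mean of \<open>w sqrt (1 - t\<^sup>2) = sqrt r\<close> is the value \<open>\<langle>sqrt R, P (sqrt R)\<rangle>\<close> at a unit vector
  of the square-summable functions. It is at most \<open>\<rho>\<close> (\<open>expectation_sqrt_ratio_le\<close>), so by Jensen's
  inequality for the logarithm the mean of \<open>- w ln (1 - t\<^sup>2)\<close> is at least \<open>2 \<bar>ln \<rho>\<bar>\<close>. Second, applying
  the Cauchy-Schwarz inequality to the mean increment of the length shows that the mean of \<open>w t\<^sup>2\<close> is
  at least \<open>(l / M)\<^sup>2\<close>, where \<open>l\<close> is the drift and \<open>M\<^sup>2\<close> the second moment (\<open>drift_le_asymmetry\<close>). As
  \<open>A\<close> is a convex and increasing function of \<open>t\<^sup>2\<close>, the mean of \<open>w A t\<close> is at least \<open>A (l / M)\<close>.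
  Both convexity arguments are carried out edge by edge, with tangents (\<open>edge_inequality\<close>).
\<close>

section \<open>Convexity of A as a function of the square\<close>

lemma A_minus: "A (- t) = A t"
  by (simp add: A_def)

lemma DERIV_A:
  assumes "\<bar>t\<bar> < 1"
  shows "(A has_real_derivative ln (1 + t) - ln (1 - t)) (at t)"
proof -
  have "((\<lambda>t. (1 + t) * ln (1 + t) + (1 - t) * ln (1 - t)) has_real_derivative ln (1 + t) - ln (1 - t)) (at t)"
    using assms by (auto intro!: derivative_eq_intros simp: abs_less_iff)
  moreover have "A = (\<lambda>t. (1 + t) * ln (1 + t) + (1 - t) * ln (1 - t))"
    by (simp add: fun_eq_iff A_def)
  ultimately show ?thesis by simp
qed

text \<open>
  For \<open>b = 2 c\<close> this function is the derivative of \<open>A t - c t\<^sup>2\<close>. Its convexity means that it changes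
  sign at most once to the right of its zero \<open>0\<close>, from negative to positive.
\<close>

lemma convex_on_deriv_A_minus_linear:
  "convex_on {0..<1} (\<lambda>t::real. ln (1 + t) - ln (1 - t) - b * t)"
proof (rule f''_ge0_imp_convex[where f' = "\<lambda>t. 1 / (1 + t) + 1 / (1 - t) - b"
      and f'' = "\<lambda>t. 1 / (1 - t)\<^sup>2 - 1 / (1 + t)\<^sup>2"])
  fix t :: real assume t: "t \<in> {0..<1}"
  show "((\<lambda>t. ln (1 + t) - ln (1 - t) - b * t) has_real_derivative 1 / (1 + t) + 1 / (1 - t) - b) (at t)"
    using t by (auto intro!: derivative_eq_intros)
  show "((\<lambda>t. 1 / (1 + t) + 1 / (1 - t) - b) has_real_derivative 1 / (1 - t)\<^sup>2 - 1 / (1 + t)\<^sup>2) (at t)"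
    using t by (auto intro!: derivative_eq_intros simp: power2_eq_square)
  have "(1 - t)\<^sup>2 \<le> (1 + t)\<^sup>2"
    using t by (intro power_mono) auto
  then show "0 \<le> 1 / (1 - t)\<^sup>2 - 1 / (1 + t)\<^sup>2"
    using t by (simp add: frac_le)
qed auto

text \<open>
  The tangent at \<open>x\<^sup>2\<close> to the convex function \<open>t\<^sup>2 \<mapsto> A t\<close>. The slope \<open>c\<close> makes the derivative \<open>\<phi>\<close> of
  \<open>A t - c t\<^sup>2\<close> vanish at \<open>x\<close>; it also vanishes at \<open>0\<close>, so by convexity \<open>\<phi>\<close> is nonpositive on
  \<open>{0..x}\<close> and nonnegative afterwards, and \<open>x\<close> is a minimum.
\<close>

lemma A_ge_parabola:
  assumes "0 \<le> x" "x < 1"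
  obtains c where "0 \<le> c" "\<And>t. \<bar>t\<bar> < 1 \<Longrightarrow> A x + c * (t\<^sup>2 - x\<^sup>2) \<le> A t"
proof -
  define c where "c = (if x = 0 then 0 else (ln (1 + x) - ln (1 - x)) / (2 * x))"
  define \<phi> where "\<phi> t = ln (1 + t) - ln (1 - t) - 2 * c * t" for t
  have c: "0 \<le> c" using assms by (simp add: c_def)
  have \<phi>x: "\<phi> x = 0" by (simp add: \<phi>_def c_def)
  have conv: "convex_on {0..<1} \<phi>"
    using convex_on_deriv_A_minus_linear[of "2 * c"] by (simp add: \<phi>_def[abs_def])
  have between: "\<phi> s \<le> (s / t) * \<phi> t" if "0 \<le> s" "s \<le> t" "t < 1" for s t
  proof (cases "t = 0")
    case False
    have "\<phi> ((1 - s / t) *\<^sub>R 0 + (s / t) *\<^sub>R t) \<le> (1 - s / t) * \<phi> 0 + (s / t) * \<phi> t"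
      using that False by (intro convex_onD[OF conv]) auto
    then show ?thesis using False by (simp add: \<phi>_def)
  qed (use that in \<open>auto simp: \<phi>_def\<close>)
  define D where "D t = A t - c * t\<^sup>2" for t
  have DD: "(D has_real_derivative \<phi> t) (at t)" if "\<bar>t\<bar> < 1" for t
    unfolding D_def[abs_def] \<phi>_def
    by (rule derivative_eq_intros DERIV_A that refl | simp)+
  have D: "D x \<le> D t" if "0 \<le> t" "t < 1" for t
  proof (cases "x \<le> t")
    case True
    have "\<phi> s \<ge> 0" if "x \<le> s" "s \<le> t" for s
    proof (cases "x = 0")
      case True
      then show ?thesis using that \<open>t < 1\<close> by (simp add: \<phi>_def c_def)
    next
      case False
      then have "0 < x / s" "0 \<le> (x / s) * \<phi> s"
        using between[of x s] that \<open>t < 1\<close> assms \<phi>x by auto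
      then show ?thesis by (simp only: zero_le_mult_iff) linarith
    qed
    then show ?thesis
      using True that assms by (intro DERIV_nonneg_imp_nondecreasing[OF True]) (auto intro!: DD exI)
  next
    case False
    have "\<phi> s \<le> 0" if "t \<le> s" "s \<le> x" for s
      using between[of s x] that \<open>0 \<le> t\<close> assms \<phi>x by simp
    then show ?thesis
      using False that assms by (intro DERIV_nonpos_imp_nonincreasing[of t x D]) (auto intro!: DD exI)
  qed
  have "A x + c * (t\<^sup>2 - x\<^sup>2) \<le> A t" if "\<bar>t\<bar> < 1" for t
  proof -
    have "D x \<le> D \<bar>t\<bar>" using D[of "\<bar>t\<bar>"] that by simp
    moreover have "A \<bar>t\<bar> = A t" by (simp add: abs_if A_minus)
    ultimately show ?thesis by (simp add: D_def algebra_simps)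
  qed
  with c show ?thesis using that by blast
qed

section \<open>Subadditive sequences\<close>

text \<open>
  Fekete's lemma, with the two one-sided bounds that accompany the convergence: geometric averages of
  the sequence are controlled through them directly.
\<close>

lemma fekete:
  fixes u :: "nat \<Rightarrow> real"
  assumes nonneg: "\<And>n. 0 \<le> u n"
    and subadd: "\<And>m n. u (m + n) \<le> u m + u n"
  obtains L where "(\<lambda>n. u n / real n) \<longlonglongrightarrow> L" "\<And>n. L * real n \<le> u n"
    "\<And>\<epsilon>. 0 < \<epsilon> \<Longrightarrow> \<exists>C. \<forall>n. u n \<le> C + (L + \<epsilon>) * real n"
proof -
  define L where "L = (INF n\<in>{1..}. u n / real n)"
  have bdd: "bdd_below ((\<lambda>n. u n / real n) ` {1..})"
    by (rule bdd_belowI[of _ 0]) (use nonneg in auto)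
  have lower: "L * real n \<le> u n" for n
  proof (cases "n = 0")
    case False
    then have "L \<le> u n / real n"
      unfolding L_def by (intro cINF_lower bdd) auto
    then show ?thesis using False by (simp add: field_simps)
  qed (use nonneg[of 0] in simp)
  have mult: "u (k * m) \<le> real k * u m + u 0" for k m
  proof (induction k)
    case (Suc k)
    have "u (Suc k * m) \<le> u m + u (k * m)" using subadd[of m "k * m"] by simp
    then show ?case using Suc by (simp add: algebra_simps)
  qed simp
  have upper: "\<exists>C. \<forall>n. u n \<le> C + (L + \<epsilon>) * real n" if "0 < \<epsilon>" for \<epsilon>
  proof -
    have "\<exists>m\<in>{1..}. u m / real m < L + \<epsilon>"
      using cINF_less_iff[OF _ bdd, of "L + \<epsilon>"] that by (auto simp: L_def)
    then obtain m where m: "1 \<le> m" "u m / real m < L + \<epsilon>" by auto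
    have "u n \<le> ((\<Sum>r<m. u r) + u 0) + (L + \<epsilon>) * real n" for n
    proof -
      \<comment> \<open>\<open>n\<close> splits into blocks of a length \<open>m\<close> with nearly optimal average, and a bounded remainder\<close>
      have "u n = u ((n div m) * m + n mod m)" by simp
      also have "\<dots> \<le> u ((n div m) * m) + u (n mod m)" by (rule subadd)
      also have "\<dots> \<le> (real (n div m) * u m + u 0) + (\<Sum>r<m. u r)"
        using m by (intro add_mono mult member_le_sum nonneg) auto
      also have "real (n div m) * u m \<le> (real n / real m) * u m"
        by (intro mult_right_mono nonneg of_nat_div_le_of_nat)
      also have "\<dots> \<le> real n * (L + \<epsilon>)"
        using m mult_left_mono[of "u m / real m" "L + \<epsilon>" "real n"] by simp
      finally show ?thesis by (simp add: algebra_simps)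
    qed
    then show ?thesis by blast
  qed
  have "(\<lambda>n. u n / real n) \<longlonglongrightarrow> L"
  proof (rule tendstoI)
    fix e :: real assume e: "0 < e"
    then obtain C where C: "\<And>n. u n \<le> C + (L + e / 2) * real n"
      using upper[of "e / 2"] by auto
    have "(\<lambda>n. C / real n) \<longlonglongrightarrow> 0" by (rule lim_const_over_n)
    then have "\<forall>\<^sub>F n in sequentially. C / real n < e / 2"
      by (rule order_tendstoD) (use e in simp)
    moreover have "\<forall>\<^sub>F n::nat in sequentially. 0 < n" by (rule eventually_gt_at_top)
    ultimately show "\<forall>\<^sub>F n in sequentially. dist (u n / real n) L < e"
    proof eventually_elim
      case (elim n)
      have "L \<le> u n / real n" using lower[of n] elim by (simp add: field_simps)
      moreover have "u n / real n \<le> C / real n + (L + e / 2)"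
        using C[of n] elim by (simp add: field_simps)
      ultimately show ?case using elim unfolding dist_real_def by linarith
    qed
  qed
  with lower upper show ?thesis using that by blast
qed

section \<open>Expectations as sums over a carrier\<close>

lemma integrable_pmf_iff_count_space:
  fixes f :: "'a \<Rightarrow> real"
  shows "integrable (measure_pmf p) f \<longleftrightarrow> integrable (count_space UNIV) (\<lambda>x. pmf p x * f x)"
  by (simp add: measure_pmf_eq_density integrable_density)

lemma expectation_eq_count_space:
  fixes f :: "'a \<Rightarrow> real"
  shows "measure_pmf.expectation p f = (\<integral>x. pmf p x * f x \<partial>count_space UNIV)"
  by (simp add: measure_pmf_eq_density integral_density)

lemma has_sum_expectation:
  fixes f :: "'a \<Rightarrow> real"
  assumes "set_pmf p \<subseteq> S" "integrable (measure_pmf p) f"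
  shows "((\<lambda>x. pmf p x * f x) has_sum measure_pmf.expectation p f) S"
proof -
  let ?g = "\<lambda>x. pmf p x * f x"
  have "Infinite_Set_Sum.abs_summable_on ?g UNIV"
    using assms(2) by (simp add: integrable_pmf_iff_count_space abs_summable_on_def)
  then have "?g summable_on UNIV" "infsum ?g UNIV = infsetsum ?g UNIV"
    by (simp_all only: abs_summable_equivalent infsetsum_infsum
        summable_on_iff_abs_summable_on_real[of ?g])
  moreover have "infsetsum ?g UNIV = measure_pmf.expectation p f"
    by (simp add: expectation_eq_count_space infsetsum_def)
  ultimately have "?g summable_on UNIV" "infsum ?g UNIV = measure_pmf.expectation p f"
    by simp_all
  then have "(?g has_sum measure_pmf.expectation p f) UNIV"
    by (metis has_sum_infsum)
  then show ?thesis
    by (rule has_sum_cong_neutral[THEN iffD1, rotated -1])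
       (use assms(1) in \<open>auto simp: set_pmf_iff\<close>)
qed

lemma integrable_pmf_if_summable_on:
  fixes f :: "'a \<Rightarrow> real"
  assumes "set_pmf p \<subseteq> S" "(\<lambda>x. pmf p x * f x) summable_on S"
  shows "integrable (measure_pmf p) f"
proof -
  let ?g = "\<lambda>x. pmf p x * f x"
  have "?g summable_on UNIV"
    by (rule summable_on_cong_neutral[THEN iffD1, OF _ _ _ assms(2)])
       (use assms(1) in \<open>auto simp: set_pmf_iff\<close>)
  then have "Infinite_Set_Sum.abs_summable_on ?g UNIV"
    by (simp only: summable_on_iff_abs_summable_on_real[of ?g] abs_summable_equivalent)
  then show ?thesis
    by (simp add: integrable_pmf_iff_count_space abs_summable_on_def)
qed

section \<open>Shannon entropy\<close>

lemma pmf_le_pmf_map: "pmf p x \<le> pmf (map_pmf f p) (f x)"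
proof -
  have "pmf p x = measure (measure_pmf p) {x}" by (simp add: pmf.rep_eq)
  also have "\<dots> \<le> measure (measure_pmf p) (f -` {f x})"
    by (rule measure_pmf.finite_measure_mono) auto
  finally show ?thesis by (simp add: pmf_map)
qed

definition surprisal :: "'a pmf \<Rightarrow> 'a \<Rightarrow> real" where
  "surprisal p x = - ln (pmf p x)"

lemma surprisal_nonneg: "0 \<le> surprisal p x"
  by (cases "pmf p x = 0") (auto simp: surprisal_def pmf_le_1 less_le)

abbreviation shannon :: "'a pmf \<Rightarrow> real" where
  "shannon p \<equiv> measure_pmf.expectation p (surprisal p)"

text \<open>
  A point is at most as likely as its image, so applying a function lowers the surprisal pointwise.
\<close>

lemma shannon_map:
  assumes "integrable (measure_pmf p) (surprisal p)"
  shows "integrable (measure_pmf (map_pmf f p)) (surprisal (map_pmf f p))"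
    and "shannon (map_pmf f p) \<le> shannon p"
proof -
  have le: "surprisal (map_pmf f p) (f x) \<le> surprisal p x" if "x \<in> set_pmf p" for x
    using that pmf_le_pmf_map[of p x f] by (simp add: surprisal_def pmf_positive)
  show *: "integrable (measure_pmf (map_pmf f p)) (surprisal (map_pmf f p))"
    unfolding integrable_map_pmf_eq
    by (rule Bochner_Integration.integrable_bound[OF assms])
       (use le in \<open>auto simp: AE_measure_pmf_iff surprisal_nonneg\<close>)
  show "shannon (map_pmf f p) \<le> shannon p"
    unfolding integral_map_pmf
    by (rule integral_mono_AE)
       (use * assms le in \<open>auto simp: AE_measure_pmf_iff\<close>)
qed

lemma integrable_pair_pmf_fst:
  fixes f :: "'a \<Rightarrow> real"
  assumes "integrable (measure_pmf p) f"
  shows "integrable (measure_pmf (pair_pmf p q)) (\<lambda>z. f (fst z))"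
  using assms integrable_map_pmf_eq[of fst "pair_pmf p q" f] by (simp add: map_fst_pair_pmf)

lemma integrable_pair_pmf_snd:
  fixes f :: "'b \<Rightarrow> real"
  assumes "integrable (measure_pmf q) f"
  shows "integrable (measure_pmf (pair_pmf p q)) (\<lambda>z. f (snd z))"
  using assms integrable_map_pmf_eq[of snd "pair_pmf p q" f] by (simp add: map_snd_pair_pmf)

lemma shannon_pair:
  assumes "integrable (measure_pmf p) (surprisal p)" "integrable (measure_pmf q) (surprisal q)"
  shows "integrable (measure_pmf (pair_pmf p q)) (surprisal (pair_pmf p q))"
    and "shannon (pair_pmf p q) = shannon p + shannon q"
proof -
  let ?s = "\<lambda>z. surprisal p (fst z) + surprisal q (snd z)"
  have eq: "AE z in measure_pmf (pair_pmf p q). surprisal (pair_pmf p q) z = ?s z"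
    by (auto simp: AE_measure_pmf_iff surprisal_def pmf_pair pmf_positive ln_mult_pos)
  have int: "integrable (measure_pmf (pair_pmf p q)) ?s"
    by (intro Bochner_Integration.integrable_add integrable_pair_pmf_fst integrable_pair_pmf_snd assms)
  show "integrable (measure_pmf (pair_pmf p q)) (surprisal (pair_pmf p q))"
    using integrable_cong_AE[OF _ _ eq] int by simp
  have "shannon (pair_pmf p q) = measure_pmf.expectation (pair_pmf p q) ?s"
    by (rule integral_cong_AE[OF _ _ eq]) auto
  also have "\<dots> = shannon p + shannon q"
    by (subst Bochner_Integration.integral_add)
       (auto intro: integrable_pair_pmf_fst integrable_pair_pmf_snd assms)
  finally show "shannon (pair_pmf p q) = shannon p + shannon q" .
qed

section \<open>Convolution powers of a step distribution\<close>

definition conv :: "('a, 'b) monoid_scheme \<Rightarrow> 'a pmf \<Rightarrow> 'a pmf \<Rightarrow> 'a pmf" where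
  "conv G p q = map_pmf (\<lambda>(x, y). x \<otimes>\<^bsub>G\<^esub> y) (pair_pmf p q)"

lemma conv_bind: "conv G p q = bind_pmf p (\<lambda>x. map_pmf (\<lambda>y. x \<otimes>\<^bsub>G\<^esub> y) q)"
  by (simp add: conv_def pair_pmf_def map_bind_pmf map_pmf_def bind_assoc_pmf bind_return_pmf)

lemma conv_pow_Suc: "conv_pow G \<mu> (Suc n) = conv G (conv_pow G \<mu> n) \<mu>"
  by (simp add: conv_def)

context group
begin

lemma set_conv: "set_pmf p \<subseteq> carrier G \<Longrightarrow> set_pmf q \<subseteq> carrier G \<Longrightarrow> set_pmf (conv G p q) \<subseteq> carrier G"
  by (auto simp: conv_def)

lemma conv_one_right: "set_pmf p \<subseteq> carrier G \<Longrightarrow> conv G p (return_pmf \<one>) = p"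
  unfolding conv_bind map_return_pmf
  by (rule trans[OF bind_pmf_cong[OF refl] bind_return_pmf']) auto

lemma conv_one_left: "set_pmf p \<subseteq> carrier G \<Longrightarrow> conv G (return_pmf \<one>) p = p"
  unfolding conv_bind bind_return_pmf
  by (rule trans[OF map_pmf_cong[OF refl, where g = "\<lambda>x. x"]]) auto

lemma conv_assoc:
  assumes "set_pmf p \<subseteq> carrier G" "set_pmf q \<subseteq> carrier G" "set_pmf r \<subseteq> carrier G"
  shows "conv G (conv G p q) r = conv G p (conv G q r)"
proof -
  have "conv G (conv G p q) r = bind_pmf p (\<lambda>x. bind_pmf q (\<lambda>y. map_pmf (\<lambda>z. x \<otimes> y \<otimes> z) r))"
    by (simp add: conv_bind bind_assoc_pmf bind_map_pmf)
  also have "\<dots> = bind_pmf p (\<lambda>x. bind_pmf q (\<lambda>y. map_pmf (\<lambda>z. x \<otimes> (y \<otimes> z)) r))"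
    using assms by (intro bind_pmf_cong map_pmf_cong refl m_assoc) auto
  also have "\<dots> = conv G p (conv G q r)"
    by (simp add: conv_bind map_bind_pmf map_pmf_comp)
  finally show ?thesis .
qed

lemma map_inv_conv:
  assumes "set_pmf p \<subseteq> carrier G" "set_pmf q \<subseteq> carrier G"
  shows "map_pmf (\<lambda>x. inv x) (conv G p q) = conv G (map_pmf (\<lambda>x. inv x) q) (map_pmf (\<lambda>x. inv x) p)"
proof -
  have "map_pmf (\<lambda>x. inv x) (conv G p q) = map_pmf (\<lambda>(x, y). inv y \<otimes> inv x) (pair_pmf p q)"
    unfolding conv_def map_pmf_comp
    using assms by (intro map_pmf_cong refl) (auto intro!: inv_mult_group)
  also have "\<dots> = map_pmf (\<lambda>(x, y). inv x \<otimes> inv y) (pair_pmf q p)"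
    by (subst pair_commute_pmf) (simp add: map_pmf_comp case_prod_unfold)
  also have "\<dots> = conv G (map_pmf (\<lambda>x. inv x) q) (map_pmf (\<lambda>x. inv x) p)"
    by (simp add: conv_def map_pair[symmetric] map_pmf_comp case_prod_unfold)
  finally show ?thesis .
qed

lemma pmf_translate:
  assumes "set_pmf q \<subseteq> carrier G" "x \<in> carrier G" "z \<in> carrier G"
  shows "pmf (map_pmf (\<lambda>y. x \<otimes> y) q) z = pmf q (inv x \<otimes> z)"
proof -
  have z: "z = x \<otimes> (inv x \<otimes> z)" using assms by (simp add: m_assoc[symmetric])
  show ?thesis
  proof (cases "inv x \<otimes> z \<in> set_pmf q")
    case True
    have "inj_on (\<lambda>y. x \<otimes> y) (set_pmf q)"
      using assms by (intro inj_onI) (metis Units_eq Units_l_cancel subsetD)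
    from pmf_map_inj[OF this True] show ?thesis by (simp only: z[symmetric])
  next
    case False
    have "z \<notin> (\<lambda>y. x \<otimes> y) ` set_pmf q"
    proof
      assume "z \<in> (\<lambda>y. x \<otimes> y) ` set_pmf q"
      then obtain y where "y \<in> set_pmf q" "z = x \<otimes> y" by auto
      then have "inv x \<otimes> z = y" using assms by (auto simp: m_assoc[symmetric])
      with False \<open>y \<in> set_pmf q\<close> show False by simp
    qed
    with False show ?thesis by (simp add: pmf_map_outside set_pmf_iff)
  qed
qed

lemma pmf_conv:
  assumes "set_pmf p \<subseteq> carrier G" "set_pmf q \<subseteq> carrier G" "z \<in> carrier G"
  shows "pmf (conv G p q) z = measure_pmf.expectation p (\<lambda>x. pmf q (inv x \<otimes> z))"
  unfolding conv_bind pmf_bind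
  using assms by (intro integral_cong_AE) (auto simp: AE_measure_pmf_iff pmf_translate)

lemma has_sum_conv:
  assumes "set_pmf p \<subseteq> carrier G" "set_pmf q \<subseteq> carrier G" "z \<in> carrier G"
  shows "((\<lambda>x. pmf p x * pmf q (inv x \<otimes> z)) has_sum pmf (conv G p q) z) (carrier G)"
  unfolding pmf_conv[OF assms]
  by (intro has_sum_expectation assms measure_pmf.integrable_const_bound[where B = 1])
     (auto simp: pmf_le_1)

end

locale random_walk = group G for G (structure) +
  fixes \<mu> :: "'a pmf"
  assumes set_step: "set_pmf \<mu> \<subseteq> carrier G"
begin

abbreviation W :: "nat \<Rightarrow> 'a pmf" where "W \<equiv> conv_pow G \<mu>"

lemma W_0: "W 0 = return_pmf \<one>" by simp

lemma W_Suc: "W (Suc n) = conv G (W n) \<mu>" by (rule conv_pow_Suc)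

declare conv_pow.simps [simp del]

lemma set_W: "set_pmf (W n) \<subseteq> carrier G"
proof (induction n)
  case 0
  then show ?case by (simp add: W_0)
next
  case (Suc n)
  then show ?case unfolding W_Suc by (rule set_conv[OF _ set_step])
qed

lemma W_add: "W (m + n) = conv G (W m) (W n)"
proof (induction n)
  case 0
  then show ?case by (simp add: W_0 conv_one_right set_W)
next
  case (Suc n)
  then show ?case by (simp add: W_Suc conv_assoc set_W set_step)
qed

lemma W_1: "W (Suc 0) = \<mu>"
  by (simp add: W_Suc W_0 conv_one_left set_step)

end

locale symmetric_walk = random_walk +
  assumes sym_step: "symmetric_pmf G \<mu>"
begin

lemma map_inv_W: "map_pmf (\<lambda>x. inv x) (W n) = W n"
proof (induction n)
  case 0
  then show ?case by (simp add: W_0)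
next
  case (Suc n)
  have step: "map_pmf (\<lambda>x. inv x) \<mu> = \<mu>"
  proof (rule pmf_eqI)
    fix x
    show "pmf (map_pmf (\<lambda>x. inv x) \<mu>) x = pmf \<mu> x"
    proof (cases "x \<in> carrier G")
      case True
      then have sym_x: "pmf \<mu> (inv x) = pmf \<mu> x"
        using sym_step[unfolded symmetric_pmf_def] by metis
      show ?thesis
      proof (cases "inv x \<in> set_pmf \<mu>")
        case x: True
        have "inj_on (\<lambda>x. inv x) (set_pmf \<mu>)"
          using set_step inj_on_subset[OF inv_inj] by blast
        from pmf_map_inj[OF this x] show ?thesis using True sym_x by simp
      next
        case False
        have "x \<notin> (\<lambda>x. inv x) ` set_pmf \<mu>"
        proof
          assume "x \<in> (\<lambda>x. inv x) ` set_pmf \<mu>"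
          then obtain y where "y \<in> set_pmf \<mu>" "x = inv y" by auto
          then show False using False set_step inv_inv[of y] by auto
        qed
        with False sym_x show ?thesis by (simp add: set_pmf_iff pmf_map_outside)
      qed
    next
      case False
      then have "x \<notin> (\<lambda>x. inv x) ` set_pmf \<mu>" "x \<notin> set_pmf \<mu>" using set_step by auto
      then show ?thesis by (simp add: set_pmf_iff pmf_map_outside)
    qed
  qed
  have "map_pmf (\<lambda>x. inv x) (W (Suc n)) = conv G \<mu> (W n)"
    using Suc step by (simp add: W_Suc map_inv_conv set_W set_step)
  also have "\<dots> = W (Suc 0 + n)" by (simp only: W_add W_1)
  finally show ?case by simp
qed

lemma pmf_W_inv: "x \<in> carrier G \<Longrightarrow> pmf (W n) (inv x) = pmf (W n) x"
proof -
  have *: "pmf (W n) x \<le> pmf (W n) (inv x)" for x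
    using pmf_le_pmf_map[of "W n" x "\<lambda>x. inv x"] by (simp add: map_inv_W)
  show "x \<in> carrier G \<Longrightarrow> pmf (W n) (inv x) = pmf (W n) x"
    using *[of x] *[of "inv x"] by simp
qed

text \<open>
  The matrix identity \<open>P\<^sup>2\<^sup>n(a, b) = \<Sum>\<^sub>k P\<^sup>n(k, a) P\<^sup>n(k, b)\<close>, where \<open>P\<^sup>n(a, b)\<close> is the probability of
  \<open>inv a \<otimes> b\<close> under the \<open>n\<close>-fold convolution. It expresses even powers as Gram matrices, which is how
  symmetry enters the bounds by the return probability.
\<close>

lemma has_sum_W_double:
  assumes "a \<in> carrier G" "b \<in> carrier G"
  shows "((\<lambda>k. pmf (W n) (inv k \<otimes> a) * pmf (W n) (inv k \<otimes> b)) has_sum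
           pmf (W (n + n)) (inv a \<otimes> b)) (carrier G)"
proof -
  let ?f = "\<lambda>x. pmf (W n) x * pmf (W n) (inv x \<otimes> (inv a \<otimes> b))"
  have "(?f has_sum pmf (W (n + n)) (inv a \<otimes> b)) (carrier G)"
    unfolding W_add using assms by (intro has_sum_conv set_W) auto
  moreover have bij: "bij_betw (\<lambda>k. inv a \<otimes> k) (carrier G) (carrier G)"
    using assms by (intro bij_betwI[where g = "\<lambda>k. a \<otimes> k"]) (auto simp: m_assoc[symmetric])
  ultimately have "((\<lambda>k. ?f (inv a \<otimes> k)) has_sum pmf (W (n + n)) (inv a \<otimes> b)) (carrier G)"
    using has_sum_reindex_bij_betw[OF bij, of ?f] by blast
  moreover have "?f (inv a \<otimes> k) = pmf (W n) (inv k \<otimes> a) * pmf (W n) (inv k \<otimes> b)"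
    if "k \<in> carrier G" for k
  proof -
    have "inv (inv a \<otimes> k) = inv k \<otimes> a" using assms that by (simp add: inv_mult_group)
    moreover from this have "pmf (W n) (inv a \<otimes> k) = pmf (W n) (inv k \<otimes> a)"
      using pmf_W_inv[of "inv a \<otimes> k" n] assms that by simp
    moreover have "inv k \<otimes> a \<otimes> (inv a \<otimes> b) = inv k \<otimes> b"
      using assms that by (metis inv_closed inv_solve_left m_assoc m_closed)
    ultimately show ?thesis by simp
  qed
  ultimately show ?thesis by (subst (asm) has_sum_cong) auto
qed

text \<open>
  Entries of a Gram matrix with constant diagonal are bounded by the diagonal.
\<close>

lemma pmf_W_even_le:
  assumes "z \<in> carrier G"
  shows "pmf (W (n + n)) z \<le> pmf (W (n + n)) \<one>"
proof -
  let ?w = "\<lambda>k a. pmf (W n) (inv k \<otimes> a)"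
  have "((\<lambda>k. 2 * (?w k \<one> * ?w k z)) has_sum 2 * pmf (W (n + n)) (inv \<one> \<otimes> z)) (carrier G)"
    using assms by (intro has_sum_cmult_right has_sum_W_double) auto
  moreover have "((\<lambda>k. ?w k \<one> * ?w k \<one> + ?w k z * ?w k z) has_sum
      (pmf (W (n + n)) (inv \<one> \<otimes> \<one>) + pmf (W (n + n)) (inv z \<otimes> z))) (carrier G)"
    using assms by (intro has_sum_add has_sum_W_double) auto
  ultimately have "2 * pmf (W (n + n)) (inv \<one> \<otimes> z) \<le>
      pmf (W (n + n)) (inv \<one> \<otimes> \<one>) + pmf (W (n + n)) (inv z \<otimes> z)"
    by (rule has_sum_mono) (use sum_squares_bound in \<open>auto simp: power2_eq_square mult.assoc\<close>)
  then show ?thesis using assms by simp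
qed

end

section \<open>The spectral radius bounds the quadratic form\<close>

lemma has_sum_finite_sum:
  fixes f :: "'i \<Rightarrow> 'a \<Rightarrow> 'b::topological_comm_monoid_add"
  assumes "finite I" "\<And>i. i \<in> I \<Longrightarrow> (f i has_sum s i) S"
  shows "((\<lambda>x. \<Sum>i\<in>I. f i x) has_sum (\<Sum>i\<in>I. s i)) S"
  using assms by (induction I rule: finite_induct) (auto intro: has_sum_add)

lemma limsup_root_bounds:
  fixes u :: "nat \<Rightarrow> real"
  assumes "\<And>n. 0 \<le> u n" "\<And>n. u n \<le> 1"
  obtains \<rho> where "limsup (\<lambda>n. ereal (root n (u n))) = ereal \<rho>" "0 \<le> \<rho>" "\<rho> \<le> 1"
proof -
  let ?l = "limsup (\<lambda>n. ereal (root n (u n)))"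
  have "root n (u n) \<le> 1" for n
    by (cases "n = 0") (use assms real_root_le_mono[of n "u n" 1] in auto)
  then have "?l \<le> ereal 1"
    by (intro Limsup_bounded) auto
  moreover have "ereal 0 \<le> liminf (\<lambda>n. ereal (root n (u n)))"
    by (rule Liminf_bounded) (use assms in \<open>auto intro!: always_eventually real_root_ge_zero\<close>)
  then have "ereal 0 \<le> ?l"
    using Liminf_le_Limsup[of sequentially "\<lambda>n. ereal (root n (u n))"] by (auto intro: order_trans)
  ultimately obtain \<rho> where "?l = ereal \<rho>" by (cases ?l) auto
  with \<open>?l \<le> ereal 1\<close> \<open>ereal 0 \<le> ?l\<close> show ?thesis by (intro that) auto
qed

text \<open>
  A multiplicative constant disappears under \<open>n\<close>-th roots, and for a bound from above by the upper
  limit it is enough to know the inequality for the exponents \<open>2 ^ k\<close>.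
\<close>

lemma le_limsup_root_if_dyadic_powers_le:
  fixes u :: "nat \<Rightarrow> real"
  assumes "limsup (\<lambda>n. ereal (root n (u n))) = ereal \<rho>" "0 \<le> \<rho>"
    and u: "\<And>n. 0 \<le> u n"
    and x: "\<And>k. 1 \<le> k \<Longrightarrow> x ^ (2 ^ k) \<le> C * u (2 ^ k)"
    and C: "0 \<le> C"
  shows "x \<le> \<rho>"
proof (rule ccontr)
  assume "\<not> x \<le> \<rho>"
  then obtain c where c: "\<rho> < c" "c < x" using dense[of \<rho> x] by auto
  then have pos: "0 < c" using assms(2) by simp
  have "\<forall>\<^sub>F n in sequentially. ereal (root n (u n)) < ereal c"
    by (rule Limsup_lessD) (use assms(1) c in simp)
  then obtain N where N: "\<And>n. N \<le> n \<Longrightarrow> root n (u n) < c"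
    by (auto simp: eventually_sequentially)
  obtain m where m: "C < (x / c) ^ m"
    using real_arch_pow[of "x / c" C] c pos by auto
  define k where "k = Suc (max m N)"
  have k: "m \<le> 2 ^ k" "N \<le> 2 ^ k"
    using less_exp[of k] by (auto simp: k_def)
  have "u (2 ^ k) = root (2 ^ k) (u (2 ^ k)) ^ (2 ^ k)"
    using u by simp
  also have "\<dots> \<le> c ^ (2 ^ k)"
    using N[OF k(2)] u by (intro power_mono) auto
  finally have "x ^ (2 ^ k) \<le> C * c ^ (2 ^ k)"
    using x[of k] mult_left_mono[OF _ C] by (fastforce simp: k_def)
  then have "(x / c) ^ (2 ^ k) \<le> C"
    using pos by (simp add: power_divide field_simps)
  moreover have "(x / c) ^ m \<le> (x / c) ^ (2 ^ k)"
    using c pos k by (intro power_increasing) auto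
  ultimately show False using m by simp
qed

context symmetric_walk
begin

text \<open>
  The quadratic form of the \<open>n\<close>-step transition matrix at the function \<open>\<phi>\<close> restricted to \<open>V\<close>.
\<close>

definition quad :: "'a set \<Rightarrow> ('a \<Rightarrow> real) \<Rightarrow> nat \<Rightarrow> real" where
  "quad V \<phi> n = (\<Sum>g\<in>V. \<Sum>h\<in>V. \<phi> g * \<phi> h * pmf (W n) (inv g \<otimes> h))"

text \<open>
  This is \<open>\<langle>\<phi>, P\<^sup>n \<phi>\<rangle>\<^sup>2 \<le> \<parallel>P\<^sup>n \<phi>\<parallel>\<^sup>2 = \<langle>\<phi>, P\<^sup>2\<^sup>n \<phi>\<rangle>\<close>, the Cauchy-Schwarz inequality for a unit vector \<open>\<phi>\<close>
  and a self-adjoint operator; \<open>\<psi>\<close> below is \<open>P\<^sup>n \<phi>\<close>. Iterating it turns the asymptotics of return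
  probabilities into a bound for \<open>\<langle>\<phi>, P \<phi>\<rangle>\<close> without spectral theory.
\<close>

lemma quad_square_le:
  assumes "finite V" "V \<subseteq> carrier G" "(\<Sum>g\<in>V. (\<phi> g)\<^sup>2) \<le> 1"
  shows "(quad V \<phi> n)\<^sup>2 \<le> quad V \<phi> (n + n)"
proof -
  define \<psi> where "\<psi> k = (\<Sum>h\<in>V. \<phi> h * pmf (W n) (inv k \<otimes> h))" for k
  have "((\<lambda>k. \<Sum>g\<in>V. \<Sum>h\<in>V. \<phi> g * \<phi> h * (pmf (W n) (inv k \<otimes> g) * pmf (W n) (inv k \<otimes> h)))
      has_sum quad V \<phi> (n + n)) (carrier G)"
    unfolding quad_def using assms
    by (intro has_sum_finite_sum has_sum_cmult_right has_sum_W_double) auto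
  moreover have "(\<Sum>g\<in>V. \<Sum>h\<in>V. \<phi> g * \<phi> h * (pmf (W n) (inv k \<otimes> g) * pmf (W n) (inv k \<otimes> h))) = (\<psi> k)\<^sup>2" for k
    by (simp add: \<psi>_def power2_eq_square sum_product mult_ac)
  ultimately have \<psi>: "((\<lambda>k. (\<psi> k)\<^sup>2) has_sum quad V \<phi> (n + n)) (carrier G)" by simp
  have le: "(\<Sum>g\<in>V. (\<psi> g)\<^sup>2) \<le> quad V \<phi> (n + n)"
    by (rule finite_sum_le_has_sum[OF \<psi>]) (use assms in auto)
  have "quad V \<phi> n = (\<Sum>g\<in>V. \<phi> g * \<psi> g)"
    by (simp add: quad_def \<psi>_def sum_distrib_left mult.assoc)
  then have "(quad V \<phi> n)\<^sup>2 \<le> (\<Sum>g\<in>V. (\<phi> g)\<^sup>2) * (\<Sum>g\<in>V. (\<psi> g)\<^sup>2)"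
    by (simp add: Cauchy_Schwarz_ineq_sum)
  also have "\<dots> \<le> 1 * (\<Sum>g\<in>V. (\<psi> g)\<^sup>2)"
    using assms by (intro mult_right_mono sum_nonneg) auto
  finally show ?thesis using le by simp
qed

lemma quad_power_le:
  assumes "finite V" "V \<subseteq> carrier G" "(\<Sum>g\<in>V. (\<phi> g)\<^sup>2) \<le> 1" "\<And>g. 0 \<le> \<phi> g"
  shows "quad V \<phi> 1 ^ (2 ^ k) \<le> quad V \<phi> (2 ^ k)"
proof (induction k)
  case (Suc k)
  have "quad V \<phi> 1 ^ (2 ^ Suc k) = (quad V \<phi> 1 ^ (2 ^ k))\<^sup>2"
    by (simp add: power_mult[symmetric] mult.commute)
  also have "\<dots> \<le> (quad V \<phi> (2 ^ k))\<^sup>2"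
    using assms(4) by (intro power_mono Suc zero_le_power) (auto simp: quad_def intro!: sum_nonneg)
  also have "\<dots> \<le> quad V \<phi> (2 ^ k + 2 ^ k)"
    by (rule quad_square_le[OF assms(1-3)])
  finally show ?case by (simp add: mult_2)
qed simp

abbreviation \<rho> :: real where "\<rho> \<equiv> spectral_radius_pmf G \<mu>"

lemma limsup_return: "limsup (\<lambda>n. ereal (root n (pmf (W n) \<one>))) = ereal \<rho>"
  and spectral_radius_nonneg: "0 \<le> \<rho>"
  and spectral_radius_le_1: "\<rho> \<le> 1"
proof -
  obtain l where l: "limsup (\<lambda>n. ereal (root n (pmf (W n) \<one>))) = ereal l" "0 \<le> l" "l \<le> 1"
    by (rule limsup_root_bounds[of "\<lambda>n. pmf (W n) \<one>"]) (auto simp: pmf_le_1)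
  moreover from this(1) have "\<rho> = l" by (simp add: spectral_radius_pmf_def)
  ultimately show "limsup (\<lambda>n. ereal (root n (pmf (W n) \<one>))) = ereal \<rho>" "0 \<le> \<rho>" "\<rho> \<le> 1"
    by simp_all
qed

text \<open>
  Finite support of \<open>\<phi>\<close> bounds \<open>\<langle>\<phi>, P\<^sup>n \<phi>\<rangle>\<close> for even \<open>n\<close> by a constant \<open>C\<close> times the return
  probability; the constant depends on the support but the resulting bound \<open>\<rho>\<close> does not.
\<close>

lemma quad_le_spectral_radius:
  assumes "finite V" "V \<subseteq> carrier G" "(\<Sum>g\<in>V. (\<phi> g)\<^sup>2) \<le> 1" "\<And>g. 0 \<le> \<phi> g"
  shows "quad V \<phi> 1 \<le> \<rho>"
proof (rule le_limsup_root_if_dyadic_powers_le[OF limsup_return spectral_radius_nonneg])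
  define C where "C = (\<Sum>g\<in>V. \<Sum>h\<in>V. \<phi> g * \<phi> h)"
  show "0 \<le> C" unfolding C_def using assms(4) by (intro sum_nonneg) auto
  fix k :: nat assume "1 \<le> k"
  then obtain j where "k = Suc j" by (cases k) auto
  then have k: "(2::nat) ^ k = 2 ^ j + 2 ^ j" by simp
  have "quad V \<phi> (2 ^ k) \<le> C * pmf (W (2 ^ k)) \<one>"
    unfolding quad_def C_def sum_distrib_right k
    using assms by (intro sum_mono mult_left_mono pmf_W_even_le) auto
  with quad_power_le[OF assms, of k] show "quad V \<phi> 1 ^ (2 ^ k) \<le> C * pmf (W (2 ^ k)) \<one>"
    by linarith
qed simp

text \<open>
  The bound \<open>\<langle>sqrt q, P (sqrt q)\<rangle> \<le> \<rho>\<close>, on finitely many edges. The square root of a probability mass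
  function is square-summable with norm \<open>1\<close> but in general not summable, hence the passage through
  finite sets \<open>V\<close> of vertices.
\<close>

lemma sum_edges_le_spectral_radius:
  assumes q: "set_pmf q \<subseteq> carrier G" and F: "finite F" "F \<subseteq> carrier G \<times> carrier G"
  shows "(\<Sum>(g, x)\<in>F. pmf \<mu> x * (sqrt (pmf q g) * sqrt (pmf q (g \<otimes> x)))) \<le> \<rho>"
proof -
  define e where "e = (\<lambda>(g, x). (g, g \<otimes> x))"
  define V where "V = fst ` e ` F \<union> snd ` e ` F"
  let ?\<phi> = "\<lambda>g. sqrt (pmf q g)"
  let ?f = "\<lambda>(g, h). ?\<phi> g * ?\<phi> h * pmf (W 1) (inv g \<otimes> h)"
  have V: "finite V" "V \<subseteq> carrier G" using F by (auto simp: V_def e_def)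
  have "inj_on e (carrier G \<times> carrier G)"
    by (auto simp: inj_on_def e_def)
  then have inj: "inj_on e F" using F(2) by (rule inj_on_subset)
  have "(\<Sum>(g, x)\<in>F. pmf \<mu> x * (?\<phi> g * ?\<phi> (g \<otimes> x))) = (\<Sum>z\<in>F. ?f (e z))"
    using F(2) by (intro sum.cong) (auto simp: e_def W_1 m_assoc[symmetric])
  also have "\<dots> = (\<Sum>z\<in>e ` F. ?f z)"
    using inj by (simp add: sum.reindex)
  also have "\<dots> \<le> (\<Sum>z\<in>V \<times> V. ?f z)"
  proof (rule sum_mono2)
    have mem_V: "fst z \<in> V" "snd z \<in> V" if "z \<in> e ` F" for z
      unfolding V_def using that by (blast intro: imageI)+
    show "e ` F \<subseteq> V \<times> V"
      by (rule subsetI) (simp only: mem_Times_iff mem_V simp_thms)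
  qed (use V in auto)
  also have "\<dots> = quad V ?\<phi> 1"
    by (simp add: quad_def sum.cartesian_product)
  also have "\<dots> \<le> \<rho>"
  proof (rule quad_le_spectral_radius[OF V])
    have "(\<Sum>g\<in>V. (?\<phi> g)\<^sup>2) = measure (measure_pmf q) V"
      using V by (simp add: measure_measure_pmf_finite)
    then show "(\<Sum>g\<in>V. (?\<phi> g)\<^sup>2) \<le> 1" by simp
  qed simp
  finally show ?thesis .
qed

end

section \<open>Mixtures\<close>

lemma pmf_mult_le_expectation:
  fixes f :: "'a \<Rightarrow> real"
  assumes "integrable (measure_pmf p) f" "\<And>x. 0 \<le> f x"
  shows "pmf p x * f x \<le> measure_pmf.expectation p f"
  using finite_sum_le_has_sum[OF has_sum_expectation[OF subset_UNIV assms(1)], of "{x}"] assms(2)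
  by simp

lemma expectation_pos:
  assumes "integrable (measure_pmf m) f" "\<And>z. z \<in> set_pmf m \<Longrightarrow> 0 < (f z :: real)"
  shows "0 < measure_pmf.expectation m f"
proof -
  have "0 \<le> measure_pmf.expectation m f"
    using assms(2) by (intro integral_nonneg_AE) (auto simp: AE_measure_pmf_iff less_imp_le)
  moreover have "measure_pmf.expectation m f \<noteq> 0"
  proof
    assume "measure_pmf.expectation m f = 0"
    then have "AE z in measure_pmf m. f z = 0"
      using assms by (subst (asm) integral_nonneg_eq_0_iff_AE) (auto simp: AE_measure_pmf_iff less_imp_le)
    then show False
      using assms(2) set_pmf_not_empty[of m] by (force simp: AE_measure_pmf_iff)
  qed
  ultimately show ?thesis by simp
qed

text \<open>
  Integrability passes from a mixture to its components; here it is recovered for \<open>Q\<close> by solving the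
  mixture equation for it.
\<close>

lemma expectation_mixture:
  fixes f :: "'a \<Rightarrow> real"
  assumes "p < 1" "\<And>x. pmf m x = p * pmf P x + (1 - p) * pmf Q x"
    and m: "integrable (measure_pmf m) f" and P: "integrable (measure_pmf P) f"
  shows "integrable (measure_pmf Q) f"
    and "measure_pmf.expectation m f = p * measure_pmf.expectation P f + (1 - p) * measure_pmf.expectation Q f"
proof -
  have eq: "pmf Q x * f x = (pmf m x * f x - p * (pmf P x * f x)) / (1 - p)" for x
    using assms(1) by (simp add: assms(2) field_simps)
  have "integrable (count_space UNIV) (\<lambda>x. (pmf m x * f x - p * (pmf P x * f x)) / (1 - p))"
    using m P unfolding integrable_pmf_iff_count_space by simp
  then show "integrable (measure_pmf Q) f"
    unfolding integrable_pmf_iff_count_space eq .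
  have "measure_pmf.expectation Q f = (measure_pmf.expectation m f - p * measure_pmf.expectation P f) / (1 - p)"
    using m P unfolding integrable_pmf_iff_count_space expectation_eq_count_space eq by simp
  then show "measure_pmf.expectation m f = p * measure_pmf.expectation P f + (1 - p) * measure_pmf.expectation Q f"
    using assms(1) by (simp add: field_simps)
qed

lemma expectation_bind_le:
  fixes f :: "'b \<Rightarrow> real"
  assumes f: "\<And>y. 0 \<le> f y" and b: "integrable (measure_pmf N) b" "\<And>n. 0 \<le> b n"
    and le: "\<And>n. (\<integral>\<^sup>+y. ennreal (f y) \<partial>measure_pmf (K n)) \<le> ennreal (b n)"
  shows "integrable (measure_pmf (bind_pmf N K)) f"
    and "measure_pmf.expectation (bind_pmf N K) f \<le> measure_pmf.expectation N b"
proof -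
  have "(\<integral>\<^sup>+y. ennreal (f y) \<partial>measure_pmf (bind_pmf N K)) \<le> (\<integral>\<^sup>+n. ennreal (b n) \<partial>measure_pmf N)"
    unfolding nn_integral_bind_pmf by (intro nn_integral_mono le)
  also have "\<dots> = ennreal (measure_pmf.expectation N b)"
    using b by (simp add: nn_integral_eq_integral)
  finally have *: "(\<integral>\<^sup>+y. ennreal (f y) \<partial>measure_pmf (bind_pmf N K)) \<le> ennreal (measure_pmf.expectation N b)" .
  then show int: "integrable (measure_pmf (bind_pmf N K)) f"
    using f by (intro integrableI_nonneg) (auto simp: le_less_trans)
  have "0 \<le> measure_pmf.expectation N b" using b by simp
  then show "measure_pmf.expectation (bind_pmf N K) f \<le> measure_pmf.expectation N b"
    using * int f by (simp add: nn_integral_eq_integral del: nn_integral_bind_pmf)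
qed

lemma expectation_bind_ge:
  fixes f :: "'b \<Rightarrow> real"
  assumes f: "\<And>y. 0 \<le> f y" and b: "integrable (measure_pmf N) b" "\<And>n. 0 \<le> b n"
    and K: "\<And>n. integrable (measure_pmf (K n)) f" "\<And>n. b n \<le> measure_pmf.expectation (K n) f"
    and int: "integrable (measure_pmf (bind_pmf N K)) f"
  shows "measure_pmf.expectation N b \<le> measure_pmf.expectation (bind_pmf N K) f"
proof -
  have "ennreal (measure_pmf.expectation N b) = (\<integral>\<^sup>+n. ennreal (b n) \<partial>measure_pmf N)"
    using b by (simp add: nn_integral_eq_integral)
  also have "\<dots> \<le> (\<integral>\<^sup>+y. ennreal (f y) \<partial>measure_pmf (bind_pmf N K))"
    unfolding nn_integral_bind_pmf using K f
    by (intro nn_integral_mono) (simp add: nn_integral_eq_integral)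
  also have "\<dots> = ennreal (measure_pmf.expectation (bind_pmf N K) f)"
    using int f by (simp add: nn_integral_eq_integral del: nn_integral_bind_pmf)
  finally show ?thesis
    using f by (subst (asm) ennreal_le_iff) (auto intro: integral_nonneg)
qed

lemma pmf_bind_ge: "pmf N n * pmf (K n) y \<le> pmf (bind_pmf N K) y"
  unfolding pmf_bind
  by (intro pmf_mult_le_expectation measure_pmf.integrable_const_bound[where B = 1]) (auto simp: pmf_le_1)

context random_walk
begin

section \<open>The walk at a geometric time\<close>

definition resolvent :: "real \<Rightarrow> 'a pmf" where
  "resolvent p = bind_pmf (geometric_pmf p) W"

lemma set_resolvent: "set_pmf (resolvent p) \<subseteq> carrier G"
  using set_W by (auto simp: resolvent_def)

text \<open>
  A geometric time is either \<open>0\<close>, with probability \<open>p\<close>, or one more than a geometric time.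
\<close>

lemma resolvent_unfold:
  assumes "0 < p" "p \<le> 1"
  shows "resolvent p = bind_pmf (bernoulli_pmf p)
           (\<lambda>b. if b then return_pmf \<one> else conv G (resolvent p) \<mu>)"
proof -
  have "resolvent p = bind_pmf (bernoulli_pmf p)
      (\<lambda>b. bind_pmf (if b then return_pmf 0 else map_pmf Suc (geometric_pmf p)) W)"
    unfolding resolvent_def
    by (subst geometric_bind_pmf_unfold) (use assms in \<open>auto simp: bind_assoc_pmf\<close>)
  also have "\<dots> = bind_pmf (bernoulli_pmf p)
      (\<lambda>b. if b then return_pmf \<one> else bind_pmf (geometric_pmf p) (\<lambda>n. conv G (W n) \<mu>))"
    by (intro bind_pmf_cong refl) (auto simp: bind_return_pmf bind_map_pmf W_0 W_Suc)
  also have "bind_pmf (geometric_pmf p) (\<lambda>n. conv G (W n) \<mu>) = conv G (resolvent p) \<mu>"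
    by (simp add: resolvent_def conv_bind bind_assoc_pmf)
  finally show ?thesis .
qed

lemma pmf_resolvent:
  assumes "0 < p" "p \<le> 1"
  shows "pmf (resolvent p) g = p * pmf (return_pmf \<one>) g + (1 - p) * pmf (conv G (resolvent p) \<mu>) g"
  by (subst resolvent_unfold[OF assms], subst pmf_bind) (use assms in simp)

lemma pmf_resolvent_step:
  assumes "0 < p" "p \<le> 1"
  shows "(1 - p) * (pmf (resolvent p) g * pmf \<mu> x) \<le> pmf (resolvent p) (g \<otimes> x)"
proof -
  have "pmf (resolvent p) g * pmf \<mu> x \<le> pmf (conv G (resolvent p) \<mu>) (g \<otimes> x)"
    using pmf_le_pmf_map[of "pair_pmf (resolvent p) \<mu>" "(g, x)" "\<lambda>(x, y). x \<otimes> y"]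
    by (simp add: conv_def pmf_pair)
  then have "(1 - p) * (pmf (resolvent p) g * pmf \<mu> x) \<le> (1 - p) * pmf (conv G (resolvent p) \<mu>) (g \<otimes> x)"
    using assms by (intro mult_left_mono) auto
  also have "\<dots> \<le> pmf (resolvent p) (g \<otimes> x)"
    using assms by (subst pmf_resolvent[OF assms]) simp
  finally show ?thesis .
qed

abbreviation edges :: "real \<Rightarrow> ('a \<times> 'a) pmf" where
  "edges p \<equiv> pair_pmf (resolvent p) \<mu>"

text \<open>
  Solving \<open>R = p \<delta>\<^sub>e + (1 - p) R * \<mu>\<close> for \<open>R * \<mu> - R\<close> and integrating \<open>f\<close>.
\<close>

lemma resolvent_increment:
  fixes f :: "'a \<Rightarrow> real"
  assumes "0 < p" "p < 1" and f: "integrable (measure_pmf (resolvent p)) f"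
  shows "integrable (measure_pmf (edges p)) (\<lambda>z. f (fst z \<otimes> snd z) - f (fst z))"
    and "measure_pmf.expectation (edges p) (\<lambda>z. f (fst z \<otimes> snd z) - f (fst z))
         = p / (1 - p) * (measure_pmf.expectation (resolvent p) f - f \<one>)"
proof -
  let ?c = "conv G (resolvent p) \<mu>"
  have ret: "integrable (measure_pmf (return_pmf \<one>)) f"
    by (rule integrable_measure_pmf_finite) simp
  have mix: "integrable (measure_pmf ?c) f"
    "measure_pmf.expectation (resolvent p) f = p * f \<one> + (1 - p) * measure_pmf.expectation ?c f"
    using expectation_mixture[OF assms(2) pmf_resolvent f ret] assms by simp_all
  then have int: "integrable (measure_pmf (edges p)) (\<lambda>z. f (fst z \<otimes> snd z))"
    and c: "measure_pmf.expectation ?c f = measure_pmf.expectation (edges p) (\<lambda>z. f (fst z \<otimes> snd z))"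
    by (simp_all add: conv_def case_prod_unfold)
  note int_fst = integrable_pair_pmf_fst[OF f, of \<mu>]
  show "integrable (measure_pmf (edges p)) (\<lambda>z. f (fst z \<otimes> snd z) - f (fst z))"
    by (intro Bochner_Integration.integrable_diff int int_fst)
  have "measure_pmf.expectation (edges p) (\<lambda>z. f (fst z \<otimes> snd z) - f (fst z))
      = measure_pmf.expectation ?c f - measure_pmf.expectation (resolvent p) f"
    by (simp add: Bochner_Integration.integral_diff[OF int int_fst] c)
  also have "\<dots> = p / (1 - p) * (measure_pmf.expectation (resolvent p) f - f \<one>)"
    using assms by (simp add: mix(2) field_simps)
  finally show "measure_pmf.expectation (edges p) (\<lambda>z. f (fst z \<otimes> snd z) - f (fst z))
         = p / (1 - p) * (measure_pmf.expectation (resolvent p) f - f \<one>)" .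
qed

end

context symmetric_walk
begin

section \<open>Reversing edges\<close>

definition flip :: "'a \<times> 'a \<Rightarrow> 'a \<times> 'a" where
  "flip z = (fst z \<otimes> snd z, inv (snd z))"

text \<open>
  By the lemma \<open>pmf_flip\<close>, this is the density of the reversed edge distribution.
\<close>

definition ratio :: "real \<Rightarrow> 'a \<times> 'a \<Rightarrow> real" where
  "ratio p z = pmf (resolvent p) (fst z \<otimes> snd z) / pmf (resolvent p) (fst z)"

lemma bij_flip: "bij_betw flip (carrier G \<times> carrier G) (carrier G \<times> carrier G)"
  by (rule bij_betwI[where g = flip]) (auto simp: flip_def m_assoc)

lemma ratio_nonneg: "0 \<le> ratio p z"
  by (simp add: ratio_def)

lemma set_edges: "set_pmf (edges p) \<subseteq> carrier G \<times> carrier G"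
  using set_resolvent set_step by auto

lemma pmf_step_inv: "x \<in> carrier G \<Longrightarrow> pmf \<mu> (inv x) = pmf \<mu> x"
  using sym_step[unfolded symmetric_pmf_def] by metis

context
  fixes p :: real
  assumes p: "0 < p" "p < 1"
begin

lemma ratio_pos: "z \<in> set_pmf (edges p) \<Longrightarrow> 0 < ratio p z"
proof -
  assume "z \<in> set_pmf (edges p)"
  then have pos: "0 < pmf (resolvent p) (fst z)" "0 < pmf \<mu> (snd z)"
    by (auto intro: pmf_positive)
  then have "0 < (1 - p) * (pmf (resolvent p) (fst z) * pmf \<mu> (snd z))"
    using p by simp
  also have "\<dots> \<le> pmf (resolvent p) (fst z \<otimes> snd z)"
    using p by (intro pmf_resolvent_step) auto
  finally show "0 < ratio p z" using pos by (simp add: ratio_def)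
qed

text \<open>
  If \<open>fst z\<close> has mass \<open>0\<close>, the quotient defining \<open>ratio\<close> is \<open>0\<close>. The reversed edge then has mass \<open>0\<close>
  too, since a step leads from its origin to \<open>fst z\<close>.
\<close>

lemma pmf_flip:
  assumes "z \<in> carrier G \<times> carrier G"
  shows "pmf (edges p) (flip z) = pmf (edges p) z * ratio p z"
proof -
  obtain g x where z: "z = (g, x)" "g \<in> carrier G" "x \<in> carrier G" using assms by auto
  show ?thesis
  proof (cases "pmf (resolvent p) g = 0")
    case True
    have "g \<otimes> x \<otimes> inv x = g" using z by (simp add: m_assoc)
    with pmf_resolvent_step[of p "g \<otimes> x" "inv x"] True p
    have "(1 - p) * (pmf (resolvent p) (g \<otimes> x) * pmf \<mu> (inv x)) \<le> 0" by simp
    then have "pmf (resolvent p) (g \<otimes> x) * pmf \<mu> (inv x) = 0"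
      using p by (auto simp: mult_le_0_iff order.antisym)
    with True show ?thesis by (simp add: z flip_def pmf_pair)
  next
    case False
    then show ?thesis using z by (simp add: flip_def pmf_pair ratio_def pmf_step_inv)
  qed
qed

lemma reversal:
  fixes f :: "'a \<times> 'a \<Rightarrow> real"
  assumes f: "integrable (measure_pmf (edges p)) f"
  shows "integrable (measure_pmf (edges p)) (\<lambda>z. ratio p z * f (flip z))"
    and "measure_pmf.expectation (edges p) (\<lambda>z. ratio p z * f (flip z)) = measure_pmf.expectation (edges p) f"
proof -
  let ?E = "measure_pmf.expectation (edges p)" and ?C = "carrier G \<times> carrier G"
  have "((\<lambda>z. pmf (edges p) (flip z) * f (flip z)) has_sum ?E f) ?C"
    using has_sum_reindex_bij_betw[OF bij_flip, of "\<lambda>z. pmf (edges p) z * f z"]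
      has_sum_expectation[OF set_edges f] by simp
  then have *: "((\<lambda>z. pmf (edges p) z * (ratio p z * f (flip z))) has_sum ?E f) ?C"
    by (rule has_sum_cong[THEN iffD1, rotated]) (simp add: pmf_flip)
  show int: "integrable (measure_pmf (edges p)) (\<lambda>z. ratio p z * f (flip z))"
    by (rule integrable_pmf_if_summable_on[OF set_edges has_sum_imp_summable[OF *]])
  show "?E (\<lambda>z. ratio p z * f (flip z)) = ?E f"
    by (rule has_sum_unique[OF has_sum_expectation[OF set_edges int] *])
qed

lemma integrable_ratio: "integrable (measure_pmf (edges p)) (ratio p)"
  and expectation_ratio: "measure_pmf.expectation (edges p) (ratio p) = 1"
  using reversal[of "\<lambda>_. 1"] by simp_all

text \<open>
  For an antisymmetric \<open>D\<close> the two sides of the reversal formula are averaged. In this form the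
  increments of the entropy and of the length are compared, since \<open>(1 - r) / 2\<close> is the product of the
  symmetrised weight \<open>(1 + r) / 2\<close> and \<open>t = (1 - r) / (1 + r)\<close>.
\<close>

lemma reversal_antisymmetric:
  fixes D :: "'a \<times> 'a \<Rightarrow> real"
  assumes D: "integrable (measure_pmf (edges p)) D"
    and anti: "\<And>z. z \<in> carrier G \<times> carrier G \<Longrightarrow> D (flip z) = - D z"
  shows "integrable (measure_pmf (edges p)) (\<lambda>z. (1 - ratio p z) / 2 * D z)"
    and "measure_pmf.expectation (edges p) (\<lambda>z. (1 - ratio p z) / 2 * D z) = measure_pmf.expectation (edges p) D"
proof -
  let ?E = "measure_pmf.expectation (edges p)"
  have eq: "AE z in measure_pmf (edges p).
      (1 - ratio p z) / 2 * D z = (D z + ratio p z * D (flip z)) / 2"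
    unfolding AE_measure_pmf_iff
  proof
    fix z assume "z \<in> set_pmf (edges p)"
    then have "D (flip z) = - D z" using anti set_edges by blast
    then show "(1 - ratio p z) / 2 * D z = (D z + ratio p z * D (flip z)) / 2"
      by (simp add: field_simps)
  qed
  have int: "integrable (measure_pmf (edges p)) (\<lambda>z. (D z + ratio p z * D (flip z)) / 2)"
    using D reversal(1)[OF D] by simp
  show "integrable (measure_pmf (edges p)) (\<lambda>z. (1 - ratio p z) / 2 * D z)"
    using integrable_cong_AE[OF _ _ eq] int by simp
  have "?E (\<lambda>z. (1 - ratio p z) / 2 * D z) = ?E (\<lambda>z. (D z + ratio p z * D (flip z)) / 2)"
    by (rule integral_cong_AE[OF _ _ eq]) auto
  also have "\<dots> = ?E D"
    using D reversal[OF D] by simp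
  finally show "?E (\<lambda>z. (1 - ratio p z) / 2 * D z) = ?E D" .
qed

lemma integrable_sqrt_ratio: "integrable (measure_pmf (edges p)) (\<lambda>z. sqrt (ratio p z))"
proof (rule Bochner_Integration.integrable_bound)
  show "integrable (measure_pmf (edges p)) (\<lambda>z. 1 + ratio p z)"
    using integrable_ratio by simp
  have "sqrt r \<le> 1 + r" if "0 \<le> r" for r :: real
    using that by (intro real_le_lsqrt) (auto simp: power2_eq_square algebra_simps)
  then show "AE z in measure_pmf (edges p). norm (sqrt (ratio p z)) \<le> norm (1 + ratio p z)"
    by (auto simp: ratio_nonneg abs_of_nonneg)
qed simp

text \<open>
  Weighted by \<open>R(g) \<mu>(x)\<close>, the root of \<open>R(g x) / R(g)\<close> becomes \<open>\<mu>(x) sqrt (R(g)) sqrt (R(g x))\<close>.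
\<close>

lemma expectation_sqrt_ratio_le: "measure_pmf.expectation (edges p) (\<lambda>z. sqrt (ratio p z)) \<le> \<rho>"
proof (rule has_sum_le_finite_sums[OF has_sum_expectation[OF set_edges integrable_sqrt_ratio]])
  fix F assume F: "finite F" "F \<subseteq> carrier G \<times> carrier G"
  have "pmf (edges p) z * sqrt (ratio p z) =
      pmf \<mu> (snd z) * (sqrt (pmf (resolvent p) (fst z)) * sqrt (pmf (resolvent p) (fst z \<otimes> snd z)))" for z
  proof (cases "pmf (resolvent p) (fst z) = 0")
    case False
    then have "pmf (resolvent p) (fst z) = sqrt (pmf (resolvent p) (fst z)) * sqrt (pmf (resolvent p) (fst z))"
      by simp
    with False show ?thesis
      by (cases z) (simp add: pmf_pair ratio_def real_sqrt_divide field_simps)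
  qed (cases z, simp add: pmf_pair)
  then have "(\<Sum>z\<in>F. pmf (edges p) z * sqrt (ratio p z)) =
      (\<Sum>(g, x)\<in>F. pmf \<mu> x * (sqrt (pmf (resolvent p) g) * sqrt (pmf (resolvent p) (g \<otimes> x))))"
    by (simp add: case_prod_unfold)
  also have "\<dots> \<le> \<rho>"
    by (rule sum_edges_le_spectral_radius[OF set_resolvent F])
  finally show "(\<Sum>z\<in>F. pmf (edges p) z * sqrt (ratio p z)) \<le> \<rho>" .
qed

lemma spectral_radius_pos: "0 < \<rho>"
  using expectation_pos[OF integrable_sqrt_ratio] ratio_pos expectation_sqrt_ratio_le
  by fastforce

end

end

section \<open>The inequality on one edge\<close>

text \<open>
  With \<open>t = (1 - r) / (1 + r)\<close> and \<open>y = sqrt (1 - t\<^sup>2)\<close>, the right-hand side is \<open>(1 + r) / 2\<close> times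
  \<open>t (ln (1 + t) - ln (1 - t)) = A t - 2 ln y\<close>. Both \<open>A\<close> and \<open>- ln\<close> are replaced by tangents: at \<open>x\<^sup>2\<close>
  in the variable \<open>t\<^sup>2\<close>, and at \<open>\<rho>\<close> in the variable \<open>y\<close>. What remains on the left is a combination of
  quantities whose means are known or bounded: \<open>1 + r\<close>, \<open>(1 + r) / 2 * t\<^sup>2\<close> and \<open>sqrt r\<close>.
\<close>

lemma edge_inequality:
  fixes r x c \<rho> :: real
  assumes r: "0 < r" and \<rho>: "0 < \<rho>"
    and c: "\<And>t. \<bar>t\<bar> < 1 \<Longrightarrow> A x + c * (t\<^sup>2 - x\<^sup>2) \<le> A t"
  shows "((A x - c * x\<^sup>2) / 2 + 1 - ln \<rho>) * (1 + r) + c * ((1 - r)\<^sup>2 / (2 * (1 + r)))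
           - 2 / \<rho> * sqrt r \<le> (1 - r) / 2 * (- ln r)"
proof -
  define t where "t = (1 - r) / (1 + r)"
  define y where "y = 2 * sqrt r / (1 + r)"
  have t: "\<bar>t\<bar> < 1" "1 + t = 2 / (1 + r)" "1 - t = 2 * r / (1 + r)"
    using r by (auto simp: t_def field_simps abs_less_iff)
  have y: "0 < y" "y\<^sup>2 = (1 + t) * (1 - t)"
    using r by (auto simp: y_def t power_mult_distrib power_divide power2_eq_square field_simps)
  have ln_t: "ln (1 + t) - ln (1 - t) = - ln r"
    using r by (simp add: t ln_div ln_mult)
  have "2 * ln y = ln (y\<^sup>2)" using y(1) by (simp add: ln_realpow)
  also have "\<dots> = ln (1 + t) + ln (1 - t)"
    unfolding y(2) using t(1) by (intro ln_mult_pos) (auto simp: abs_less_iff)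
  finally have ln_y: "2 * ln y = ln (1 + t) + ln (1 - t)" .
  have "ln y - ln \<rho> \<le> y / \<rho> - 1"
    using ln_le_minus_one[of "y / \<rho>"] y(1) \<rho> by (simp add: ln_div)
  then have "A x + c * (t\<^sup>2 - x\<^sup>2) + 2 * (1 - ln \<rho>) - 2 * y / \<rho> \<le> A t - 2 * ln y"
    using c[OF t(1)] by simp
  also have "A t - 2 * ln y = t * (ln (1 + t) - ln (1 - t))"
    unfolding ln_y by (simp add: A_def algebra_simps)
  finally have "A x + c * (t\<^sup>2 - x\<^sup>2) + 2 * (1 - ln \<rho>) - 2 * y / \<rho> \<le> t * (- ln r)"
    unfolding ln_t .
  then have scaled: "(1 + r) / 2 * (A x + c * (t\<^sup>2 - x\<^sup>2) + 2 * (1 - ln \<rho>) - 2 * y / \<rho>)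
      \<le> (1 + r) / 2 * (t * (- ln r))"
    using r by (intro mult_left_mono) auto
  have lhs: "(1 + r) / 2 * (A x + c * (t\<^sup>2 - x\<^sup>2) + 2 * (1 - ln \<rho>) - 2 * y / \<rho>)
      = ((A x - c * x\<^sup>2) / 2 + 1 - ln \<rho>) * (1 + r) + c * ((1 + r) * t\<^sup>2 / 2) - (1 + r) * y / \<rho>"
    by (simp add: algebra_simps add_divide_distrib diff_divide_distrib)
  have t2: "(1 + r) * t\<^sup>2 / 2 = (1 - r)\<^sup>2 / (2 * (1 + r))"
    using r by (simp add: t_def power2_eq_square divide_simps)
  have y1: "(1 + r) * y / \<rho> = 2 / \<rho> * sqrt r"
    using r by (simp add: y_def)
  have rhs: "(1 + r) / 2 * (t * (- ln r)) = (1 - r) / 2 * (- ln r)"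
    using r by (simp add: t_def divide_simps)
  from scaled show ?thesis unfolding lhs t2 y1 rhs .
qed

section \<open>The entropy of the walk at a geometric time\<close>

lemma shannon_nonneg: "0 \<le> shannon p"
  by (intro Bochner_Integration.integral_nonneg surprisal_nonneg)

lemma shannon_conv:
  assumes "integrable (measure_pmf p) (surprisal p)" "integrable (measure_pmf q) (surprisal q)"
  shows "integrable (measure_pmf (conv G p q)) (surprisal (conv G p q))"
    and "shannon (conv G p q) \<le> shannon p + shannon q"
  unfolding conv_def
  using shannon_map[OF shannon_pair(1)[OF assms], of "\<lambda>(x, y). x \<otimes>\<^bsub>G\<^esub> y"] shannon_pair(2)[OF assms]
  by auto

context random_walk
begin

lemma integrable_surprisal_W:
  assumes "integrable (measure_pmf \<mu>) (surprisal \<mu>)"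
  shows "integrable (measure_pmf (W n)) (surprisal (W n))"
proof (induction n)
  case 0
  show ?case unfolding W_0 by (rule integrable_measure_pmf_finite) simp
qed (auto simp: W_Suc intro: shannon_conv assms)

lemma shannon_W_add_le:
  assumes "integrable (measure_pmf \<mu>) (surprisal \<mu>)"
  shows "shannon (W (m + n)) \<le> shannon (W m) + shannon (W n)"
  unfolding W_add by (intro shannon_conv integrable_surprisal_W assms)

text \<open>
  Conditioning on the geometric time bounds the entropy of the mixture by the mean of the entropies of
  its components plus the entropy of the time. The latter contributes the terms in \<open>ln p\<close> and
  \<open>ln (1 - p)\<close>, which vanish in the limit \<open>p \<longlonglongrightarrow> 0\<close> after multiplication by \<open>p / (1 - p)\<close>.
\<close>

lemma shannon_resolvent_le:
  assumes p: "0 < p" "p < 1"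
    and ent: "integrable (measure_pmf \<mu>) (surprisal \<mu>)"
    and bound: "\<And>n. shannon (W n) \<le> C + h * real n"
  shows "integrable (measure_pmf (resolvent p)) (surprisal (resolvent p))"
    and "p / (1 - p) * shannon (resolvent p) \<le> p / (1 - p) * (C - ln p) + h - ln (1 - p)"
proof -
  define b where "b n = (C - ln p) + (h - ln (1 - p)) * real n" for n
  have b_eq: "b n = surprisal (geometric_pmf p) n + (C + h * real n)" for n
    using p by (simp add: b_def surprisal_def ln_mult ln_realpow algebra_simps)
  have b_ge: "surprisal (geometric_pmf p) n + shannon (W n) \<le> b n" for n
    using bound[of n] by (simp add: b_eq)
  have b_nonneg: "0 \<le> b n" for n
    using b_ge[of n] surprisal_nonneg[of "geometric_pmf p" n] shannon_nonneg[of "W n"] by linarith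
  have int_b: "integrable (measure_pmf (geometric_pmf p)) b"
    unfolding b_def using integrable_real_geometric_pmf[of p] p by simp
  have "(\<integral>\<^sup>+g. ennreal (surprisal (resolvent p) g) \<partial>measure_pmf (W n)) \<le> ennreal (b n)" for n
  proof -
    have "surprisal (resolvent p) g \<le> surprisal (geometric_pmf p) n + surprisal (W n) g"
      if "g \<in> set_pmf (W n)" for g
    proof -
      have pos: "0 < pmf (geometric_pmf p) n" "0 < pmf (W n) g"
        using p that by (auto intro: pmf_positive)
      then have "ln (pmf (geometric_pmf p) n * pmf (W n) g) \<le> ln (pmf (resolvent p) g)"
        using pmf_bind_ge[of "geometric_pmf p" n W g] by (intro ln_mono) (auto simp: resolvent_def)
      then show ?thesis using ln_mult_pos[OF pos] unfolding surprisal_def by linarith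
    qed
    then have "(\<integral>\<^sup>+g. ennreal (surprisal (resolvent p) g) \<partial>measure_pmf (W n))
        \<le> (\<integral>\<^sup>+g. ennreal (surprisal (geometric_pmf p) n + surprisal (W n) g) \<partial>measure_pmf (W n))"
      by (intro nn_integral_mono_AE) (auto simp: AE_measure_pmf_iff intro!: ennreal_leI)
    also have "\<dots> = ennreal (surprisal (geometric_pmf p) n + shannon (W n))"
      using integrable_surprisal_W[OF ent, of n]
      by (subst nn_integral_eq_integral) (auto simp: surprisal_nonneg)
    also have "\<dots> \<le> ennreal (b n)" by (rule ennreal_leI[OF b_ge])
    finally show ?thesis .
  qed
  note bind = expectation_bind_le[of "surprisal (resolvent p)" _ b W, OF surprisal_nonneg int_b b_nonneg this]
  show "integrable (measure_pmf (resolvent p)) (surprisal (resolvent p))"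
    using bind(1) by (simp add: resolvent_def)
  have "shannon (resolvent p) \<le> measure_pmf.expectation (geometric_pmf p) b"
    using bind(2) by (simp add: resolvent_def)
  also have "\<dots> = (C - ln p) + (h - ln (1 - p)) * ((1 - p) / p)"
    unfolding b_def using integrable_real_geometric_pmf[of p] expectation_geometric_pmf[of p] p by simp
  finally have "p / (1 - p) * shannon (resolvent p)
      \<le> p / (1 - p) * ((C - ln p) + (h - ln (1 - p)) * ((1 - p) / p))"
    using p by (intro mult_left_mono) auto
  also have "\<dots> = p / (1 - p) * (C - ln p) + h - ln (1 - p)"
    using p by (simp add: distrib_left)
  finally show "p / (1 - p) * shannon (resolvent p) \<le> p / (1 - p) * (C - ln p) + h - ln (1 - p)" .
qed

end

section \<open>Length functions and drift\<close>

text \<open>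
  Only the length \<open>len g\<close>, the distance from \<open>g\<close> to the identity, enters the drift and the second
  moment; left invariance of the distance makes it subadditive and inversion invariant.
\<close>

locale length_walk = symmetric_walk +
  fixes len :: "'a \<Rightarrow> real"
  assumes len_nonneg: "0 \<le> len g"
    and len_one: "len \<one> = 0"
    and len_mult: "g \<in> carrier G \<Longrightarrow> x \<in> carrier G \<Longrightarrow> len (g \<otimes> x) \<le> len g + len x"
    and len_inv: "g \<in> carrier G \<Longrightarrow> len (inv g) = len g"
    and second_moment: "integrable (measure_pmf \<mu>) (\<lambda>x. (len x)\<^sup>2)"
begin

lemma integrable_len_step: "integrable (measure_pmf \<mu>) len"
proof (rule Bochner_Integration.integrable_bound)
  show "integrable (measure_pmf \<mu>) (\<lambda>x. 1 + (len x)\<^sup>2)" using second_moment by simp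
  have "l \<le> 1 + l\<^sup>2" for l :: real
    using sum_squares_bound[of 1 l] zero_le_power2[of l] by (simp add: power2_eq_square) (smt (verit) zero_le_square)
  then show "AE x in measure_pmf \<mu>. norm (len x) \<le> norm (1 + (len x)\<^sup>2)"
    by (auto simp: len_nonneg abs_of_nonneg)
qed simp

lemma len_conv:
  assumes "set_pmf p \<subseteq> carrier G" "set_pmf q \<subseteq> carrier G"
    and "integrable (measure_pmf p) len" "integrable (measure_pmf q) len"
  shows "integrable (measure_pmf (conv G p q)) len"
    and "measure_pmf.expectation (conv G p q) len
           \<le> measure_pmf.expectation p len + measure_pmf.expectation q len"
proof -
  let ?s = "\<lambda>z. len (fst z) + len (snd z)"
  have le: "AE z in measure_pmf (pair_pmf p q). len (fst z \<otimes> snd z) \<le> ?s z"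
    using assms by (auto simp: AE_measure_pmf_iff intro!: len_mult)
  have s: "integrable (measure_pmf (pair_pmf p q)) ?s"
    by (intro Bochner_Integration.integrable_add integrable_pair_pmf_fst integrable_pair_pmf_snd assms)
  have int: "integrable (measure_pmf (pair_pmf p q)) (\<lambda>z. len (fst z \<otimes> snd z))"
    by (rule Bochner_Integration.integrable_bound[OF s])
       (use le in \<open>auto simp: len_nonneg abs_of_nonneg\<close>)
  then show "integrable (measure_pmf (conv G p q)) len"
    by (simp add: conv_def case_prod_unfold)
  have "measure_pmf.expectation (conv G p q) len = measure_pmf.expectation (pair_pmf p q) (\<lambda>z. len (fst z \<otimes> snd z))"
    by (simp add: conv_def case_prod_unfold)
  also have "\<dots> \<le> measure_pmf.expectation (pair_pmf p q) ?s"
    by (rule integral_mono_AE[OF int s le])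
  also have "\<dots> = measure_pmf.expectation p len + measure_pmf.expectation q len"
    using assms by (subst Bochner_Integration.integral_add)
      (auto intro: integrable_pair_pmf_fst integrable_pair_pmf_snd)
  finally show "measure_pmf.expectation (conv G p q) len
           \<le> measure_pmf.expectation p len + measure_pmf.expectation q len" .
qed

abbreviation L :: "nat \<Rightarrow> real" where "L n \<equiv> measure_pmf.expectation (W n) len"

lemma integrable_len_W: "integrable (measure_pmf (W n)) len"
proof (induction n)
  case 0
  show ?case unfolding W_0 by (rule integrable_measure_pmf_finite) simp
next
  case (Suc n)
  then show ?case unfolding W_Suc by (intro len_conv set_W set_step integrable_len_step)
qed

lemma L_add_le: "L (m + n) \<le> L m + L n"
  unfolding W_add by (intro len_conv set_W integrable_len_W)

lemma L_nonneg: "0 \<le> L n"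
  by (simp add: len_nonneg)

lemma L_le_mult: "L n \<le> real n * L 1"
proof (induction n)
  case (Suc n)
  have "L (Suc n) \<le> L n + L 1" using L_add_le[of n 1] by simp
  with Suc show ?case by (simp add: algebra_simps)
qed (simp add: W_0 len_one)

context
  fixes p :: real
  assumes p: "0 < p" "p < 1"
begin

lemma integrable_len_resolvent: "integrable (measure_pmf (resolvent p)) len"
  unfolding resolvent_def
proof (rule expectation_bind_le(1))
  show "integrable (measure_pmf (geometric_pmf p)) (\<lambda>n. real n * L 1)"
    using integrable_real_geometric_pmf[of p] p by simp
  show "(\<integral>\<^sup>+y. ennreal (len y) \<partial>measure_pmf (W n)) \<le> ennreal (real n * L 1)" for n
    using integrable_len_W[of n] L_le_mult[of n]
    by (simp add: nn_integral_eq_integral len_nonneg ennreal_leI)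
qed (auto simp: len_nonneg)

text \<open>
  The mean length at time \<open>n\<close> is at least \<open>l n\<close>, and the geometric time has mean \<open>(1 - p) / p\<close>.
\<close>

lemma drift_le_increment:
  assumes "0 \<le> l" "\<And>n. l * real n \<le> L n"
  shows "l \<le> measure_pmf.expectation (edges p) (\<lambda>z. len (fst z \<otimes> snd z) - len (fst z))"
proof -
  have "l * ((1 - p) / p) = measure_pmf.expectation (geometric_pmf p) (\<lambda>n. l * real n)"
    using expectation_geometric_pmf[of p] p by simp
  also have "\<dots> \<le> measure_pmf.expectation (resolvent p) len"
    unfolding resolvent_def
    using assms integrable_real_geometric_pmf[of p] p integrable_len_resolvent[unfolded resolvent_def]
    by (intro expectation_bind_ge integrable_len_W) (auto simp: len_nonneg)
  finally have "p / (1 - p) * (l * ((1 - p) / p)) \<le> p / (1 - p) * measure_pmf.expectation (resolvent p) len"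
    using p by (intro mult_left_mono) auto
  then show ?thesis
    using p by (simp add: resolvent_increment(2)[OF p integrable_len_resolvent] len_one)
qed

text \<open>
  The mean of \<open>t\<^sup>2\<close> for \<open>t = (1 - r) / (1 + r)\<close>, with respect to the weight \<open>(1 + r) / 2\<close>.
\<close>

definition asymmetry :: real where
  "asymmetry = measure_pmf.expectation (edges p) (\<lambda>z. (1 - ratio p z)\<^sup>2 / (2 * (1 + ratio p z)))"

lemma integrable_asymmetry:
  "integrable (measure_pmf (edges p)) (\<lambda>z. (1 - ratio p z)\<^sup>2 / (2 * (1 + ratio p z)))"
proof (rule Bochner_Integration.integrable_bound)
  show "integrable (measure_pmf (edges p)) (\<lambda>z. 1 + ratio p z)"
    using integrable_ratio[OF p] by simp
  have "(1 - r)\<^sup>2 / (2 * (1 + r)) \<le> 1 + r" if "0 \<le> r" for r :: real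
    using that by (simp add: divide_le_eq power2_eq_square algebra_simps)
  then show "AE z in measure_pmf (edges p).
      norm ((1 - ratio p z)\<^sup>2 / (2 * (1 + ratio p z))) \<le> norm (1 + ratio p z)"
    by (auto simp: ratio_nonneg abs_of_nonneg)
qed simp

lemma asymmetry_nonneg: "0 \<le> asymmetry"
  unfolding asymmetry_def by (intro Bochner_Integration.integral_nonneg) (simp add: ratio_nonneg)

text \<open>
  The weight \<open>(1 + r) / 2\<close> has mean \<open>1\<close>, and \<open>t\<^sup>2 < 1\<close> on every edge because \<open>r > 0\<close>. Together with the
  next lemma this places \<open>l / M\<close> in the interval where \<open>A\<close> is differentiable.
\<close>

lemma asymmetry_less_1: "asymmetry < 1"
proof -
  let ?f = "\<lambda>z. (1 + ratio p z) / 2 - (1 - ratio p z)\<^sup>2 / (2 * (1 + ratio p z))"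
  have int: "integrable (measure_pmf (edges p)) ?f"
    using integrable_ratio[OF p] integrable_asymmetry by simp
  have "(1 + r) / 2 - (1 - r)\<^sup>2 / (2 * (1 + r)) = 2 * r / (1 + r)" if "0 < r" for r :: real
    using that by (simp add: field_simps power2_eq_square)
  then have "0 < ?f z" if "z \<in> set_pmf (edges p)" for z
    using ratio_pos[OF p that] by simp
  then have "0 < measure_pmf.expectation (edges p) ?f"
    by (rule expectation_pos[OF int])
  also have "\<dots> = 1 - asymmetry"
    using integrable_ratio[OF p] integrable_asymmetry
    by (simp add: asymmetry_def expectation_ratio[OF p])
  finally show ?thesis by simp
qed

text \<open>
  The length changes along an edge by at most the length of the step, so the drift is at most the
  weighted mean of \<open>\<bar>t\<bar> len x\<close>. The Cauchy-Schwarz bound of this mean is obtained from the inequality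
  \<open>2 \<bar>t\<bar> len x \<le> (M\<^sup>2 / l) t\<^sup>2 + (l / M\<^sup>2) (len x)\<^sup>2\<close>, which after
  integration is optimal for the claim.
\<close>

lemma drift_le_asymmetry:
  assumes l: "0 \<le> l" "\<And>n. l * real n \<le> L n"
  defines "M \<equiv> sqrt (measure_pmf.expectation \<mu> (\<lambda>x. (len x)\<^sup>2))"
  shows "(l / M)\<^sup>2 \<le> asymmetry"
proof (cases "l / M = 0")
  case True
  show ?thesis unfolding True by (simp add: asymmetry_nonneg)
next
  case False
  let ?E = "measure_pmf.expectation (edges p)" and ?r = "ratio p"
  define x where "x = l / M"
  have nn: "0 \<le> measure_pmf.expectation \<mu> (\<lambda>x. (len x)\<^sup>2)" by simp
  have M: "0 < M" "M\<^sup>2 = measure_pmf.expectation \<mu> (\<lambda>x. (len x)\<^sup>2)"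
    using False nn by (auto simp: M_def less_le)
  have x: "0 < x" "l = x * M" using False l(1) M by (auto simp: x_def less_le)
  let ?D = "\<lambda>z. len (fst z \<otimes> snd z) - len (fst z)"
  let ?a = "\<lambda>z. (1 - ?r z)\<^sup>2 / (2 * (1 + ?r z))" and ?s = "\<lambda>z. (len (snd z))\<^sup>2"
  have int_D: "integrable (measure_pmf (edges p)) ?D"
    by (rule resolvent_increment(1)[OF p integrable_len_resolvent])
  have anti: "?D (flip z) = - ?D z" if "z \<in> carrier G \<times> carrier G" for z
    using that by (auto simp: flip_def m_assoc)
  note D = reversal_antisymmetric[OF p int_D anti]
  have int_s: "integrable (measure_pmf (edges p)) ?s"
    by (rule integrable_pair_pmf_snd[OF second_moment])
  have E_s: "?E ?s = M\<^sup>2"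
    unfolding M(2) by (rule expectation_pair_pmf_snd[where f = "\<lambda>x. (len x)\<^sup>2"])
  have AE_s: "AE z in measure_pmf (edges p). ?r z * ?s (flip z) = ?r z * ?s z"
    using set_step by (auto simp: AE_measure_pmf_iff flip_def len_inv)
  have int_rs: "integrable (measure_pmf (edges p)) (\<lambda>z. ?r z * ?s z)"
    using reversal(1)[OF p int_s] integrable_cong_AE[OF _ _ AE_s] by simp
  have E_rs: "?E (\<lambda>z. ?r z * ?s z) = M\<^sup>2"
    using reversal(2)[OF p int_s] integral_cong_AE[OF _ _ AE_s] E_s by simp
  let ?b = "\<lambda>z. M / (2 * x) * ?a z + x / (4 * M) * (?s z + ?r z * ?s z)"
  have ints: "integrable (measure_pmf (edges p)) (\<lambda>z. M / (2 * x) * ?a z)"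
    "integrable (measure_pmf (edges p)) (\<lambda>z. x / (4 * M) * (?s z + ?r z * ?s z))"
    by (intro Bochner_Integration.integrable_add integrable_mult_right
        integrable_asymmetry int_s int_rs)+
  note int_b = Bochner_Integration.integrable_add[OF ints]
  have le: "AE z in measure_pmf (edges p). (1 - ?r z) / 2 * ?D z \<le> ?b z"
    unfolding AE_measure_pmf_iff
  proof
    fix z assume "z \<in> set_pmf (edges p)"
    from subsetD[OF set_edges this] have z: "fst z \<in> carrier G" "snd z \<in> carrier G" by auto
    have "len (fst z) \<le> len (fst z \<otimes> snd z) + len (inv (snd z))"
      using len_mult[of "fst z \<otimes> snd z" "inv (snd z)"] z by (simp add: m_assoc)
    then have D_le: "\<bar>?D z\<bar> \<le> len (snd z)"
      using len_mult[of "fst z" "snd z"] z by (simp add: len_inv abs_le_iff)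
    define r where "r = ?r z"
    have r: "0 \<le> r" by (simp add: r_def ratio_nonneg)
    define u where "u = \<bar>1 - r\<bar> / (1 + r)"
    have u: "\<bar>1 - r\<bar> = (1 + r) * u" using r by (simp add: u_def)
    have "(1 - r) / 2 * ?D z \<le> \<bar>1 - r\<bar> / 2 * len (snd z)"
    proof -
      have "(1 - r) / 2 * ?D z \<le> \<bar>(1 - r) / 2 * ?D z\<bar>" by (rule abs_ge_self)
      also have "\<dots> = \<bar>1 - r\<bar> / 2 * \<bar>?D z\<bar>" by (simp add: abs_mult)
      also have "\<dots> \<le> \<bar>1 - r\<bar> / 2 * len (snd z)" by (intro mult_left_mono D_le) auto
      finally show ?thesis .
    qed
    also have "\<dots> = (1 + r) / 4 * (2 * u * len (snd z))"
      by (simp add: u)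
    also have "\<dots> \<le> (1 + r) / 4 * ((M / x) * u\<^sup>2 + (x / M) * (len (snd z))\<^sup>2)"
    proof (rule mult_left_mono)
      have "0 \<le> (M / x) * (u - x / M * len (snd z))\<^sup>2" using M(1) x(1) by simp
      also have "\<dots> = (M / x) * u\<^sup>2 + (x / M) * (len (snd z))\<^sup>2 - 2 * u * len (snd z)"
        using M(1) x(1) by (simp add: power2_eq_square field_simps)
      finally show "2 * u * len (snd z) \<le> (M / x) * u\<^sup>2 + (x / M) * (len (snd z))\<^sup>2" by simp
    qed (use r in simp)
    also have "\<dots> = M / (2 * x) * ((1 + r) * u\<^sup>2 / 2)
        + x / (4 * M) * ((len (snd z))\<^sup>2 + r * (len (snd z))\<^sup>2)"
      by (simp add: algebra_simps add_divide_distrib)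
    also have "(1 + r) * u\<^sup>2 / 2 = (1 - r)\<^sup>2 / (2 * (1 + r))"
      using r by (simp add: u_def power2_eq_square divide_simps)
    finally show "(1 - ?r z) / 2 * ?D z \<le> ?b z" by (simp add: r_def)
  qed
  have "x * M = l" by (simp add: x)
  also have "l \<le> ?E ?D" by (rule drift_le_increment[OF l])
  also have "\<dots> = ?E (\<lambda>z. (1 - ?r z) / 2 * ?D z)" by (rule D(2)[symmetric])
  also have "\<dots> \<le> ?E ?b" by (rule integral_mono_AE[OF D(1) int_b le])
  also have "\<dots> = M / (2 * x) * asymmetry + x / (4 * M) * (M\<^sup>2 + M\<^sup>2)"
    by (simp only: Bochner_Integration.integral_add[OF ints] integral_mult_right_zero
        Bochner_Integration.integral_add[OF int_s int_rs] asymmetry_def E_s E_rs)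
  also have "\<dots> = (M / x) * asymmetry / 2 + x * M / 2"
    using M(1) by (simp add: power2_eq_square mult.commute)
  finally have "x * M \<le> (M / x) * asymmetry" by simp
  then have "x\<^sup>2 * M \<le> asymmetry * M"
    using x(1) by (simp add: field_simps power2_eq_square)
  then show ?thesis using M(1) by (simp add: x_def)
qed

section \<open>Drift, spectral radius and entropy\<close>

text \<open>
  The inequality on one edge, integrated. The tangent slope \<open>c\<close> is nonnegative, so the lower bound for
  the asymmetry may be inserted, and likewise the upper bound \<open>\<rho>\<close> for the mean of \<open>sqrt r\<close>.
\<close>

lemma resolvent_inequality:
  assumes l: "0 \<le> l" "\<And>n. l * real n \<le> L n"
    and ent: "integrable (measure_pmf (resolvent p)) (surprisal (resolvent p))"
  shows "A (l / sqrt (measure_pmf.expectation \<mu> (\<lambda>x. (len x)\<^sup>2))) + 2 * \<bar>ln \<rho>\<bar>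
           \<le> p / (1 - p) * shannon (resolvent p)"
proof -
  let ?E = "measure_pmf.expectation (edges p)" and ?r = "ratio p"
  define x where "x = l / sqrt (measure_pmf.expectation \<mu> (\<lambda>x. (len x)\<^sup>2))"
  have x: "0 \<le> x" using l(1) by (simp add: x_def)
  have x2: "x\<^sup>2 \<le> asymmetry" unfolding x_def by (rule drift_le_asymmetry[OF l])
  have "x\<^sup>2 < 1\<^sup>2" using x2 asymmetry_less_1 by simp
  then have x1: "x < 1" by (rule power2_less_imp_less) simp
  obtain c where c: "0 \<le> c" "\<And>t. \<bar>t\<bar> < 1 \<Longrightarrow> A x + c * (t\<^sup>2 - x\<^sup>2) \<le> A t"
    using A_ge_parabola[OF x x1] by blast
  note \<rho>_pos = spectral_radius_pos[OF p]
  let ?k = "\<lambda>z. surprisal (resolvent p) (fst z \<otimes> snd z) - surprisal (resolvent p) (fst z)"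
  note k = resolvent_increment[OF p ent]
  have anti: "?k (flip z) = - ?k z" if "z \<in> carrier G \<times> carrier G" for z
    using that by (auto simp: flip_def m_assoc)
  note sk = reversal_antisymmetric[OF p k(1) anti]
  have k_eq: "?k z = - ln (?r z)" if "z \<in> set_pmf (edges p)" for z
  proof -
    have "0 < ?r z" "0 < pmf (resolvent p) (fst z)"
      using ratio_pos[OF p that] that by (auto intro: pmf_positive)
    moreover from this have "0 < pmf (resolvent p) (fst z \<otimes> snd z)"
      by (simp add: ratio_def zero_less_divide_iff)
    ultimately show ?thesis by (simp add: surprisal_def ratio_def ln_div)
  qed
  define K where "K = (A x - c * x\<^sup>2) / 2 + 1 - ln \<rho>"
  let ?a = "\<lambda>z. (1 - ?r z)\<^sup>2 / (2 * (1 + ?r z))" and ?s = "\<lambda>z. sqrt (?r z)"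
  let ?g = "\<lambda>z. K * (1 + ?r z) + c * ?a z - 2 / \<rho> * ?s z"
  have ints: "integrable (measure_pmf (edges p)) (\<lambda>z. K * (1 + ?r z))"
    "integrable (measure_pmf (edges p)) (\<lambda>z. c * ?a z)"
    "integrable (measure_pmf (edges p)) (\<lambda>z. 2 / \<rho> * ?s z)"
    using integrable_ratio[OF p] integrable_asymmetry integrable_sqrt_ratio[OF p]
    by (intro integrable_mult_right; simp)+
  note int_g = Bochner_Integration.integrable_diff[OF Bochner_Integration.integrable_add[OF ints(1,2)] ints(3)]
  have E_r: "?E (\<lambda>z. 1 + ?r z) = 2"
    using integrable_ratio[OF p] by (simp add: expectation_ratio[OF p])
  have le: "AE z in measure_pmf (edges p). ?g z \<le> (1 - ?r z) / 2 * ?k z"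
    unfolding AE_measure_pmf_iff
  proof
    fix z assume z: "z \<in> set_pmf (edges p)"
    show "?g z \<le> (1 - ?r z) / 2 * ?k z"
      unfolding k_eq[OF z] K_def by (rule edge_inequality[OF ratio_pos[OF p z] \<rho>_pos c(2)])
  qed
  have "A x + 2 * \<bar>ln \<rho>\<bar> = A x - 2 * ln \<rho>"
    using \<rho>_pos spectral_radius_le_1 by simp
  also have "\<dots> \<le> K * 2 + c * asymmetry - 2 / \<rho> * ?E ?s"
  proof -
    have "c * x\<^sup>2 \<le> c * asymmetry" using c x2 by (intro mult_left_mono)
    moreover have "2 / \<rho> * ?E (\<lambda>z. sqrt (?r z)) \<le> 2 / \<rho> * \<rho>"
      using \<rho>_pos by (intro mult_left_mono expectation_sqrt_ratio_le[OF p]) auto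
    moreover have "K * 2 = A x - c * x\<^sup>2 + 2 - 2 * ln \<rho>" "2 / \<rho> * \<rho> = 2"
      using \<rho>_pos by (simp_all add: K_def)
    ultimately show ?thesis by linarith
  qed
  also have "\<dots> = ?E ?g"
    by (simp only: Bochner_Integration.integral_diff[OF Bochner_Integration.integrable_add[OF ints(1,2)] ints(3)]
        Bochner_Integration.integral_add[OF ints(1,2)] integral_mult_right_zero E_r asymmetry_def)
  also have "\<dots> \<le> ?E (\<lambda>z. (1 - ?r z) / 2 * ?k z)"
    by (rule integral_mono_AE[OF int_g sk(1) le])
  also have "\<dots> = p / (1 - p) * (shannon (resolvent p) - surprisal (resolvent p) \<one>)"
    by (simp only: sk(2) k(2))
  also have "\<dots> \<le> p / (1 - p) * shannon (resolvent p)"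
    using p surprisal_nonneg[of "resolvent p" \<one>] by (intro mult_left_mono) auto
  finally show ?thesis unfolding x_def .
qed

end

text \<open>
  The bound \<open>C + (h + \<epsilon>) n\<close> for the entropy at time \<open>n\<close>, with \<open>C\<close> independent of \<open>n\<close>, is averaged over
  the geometric time before \<open>p\<close> tends to \<open>0\<close>.
\<close>

theorem drift_spectral_radius_entropy:
  assumes ent: "integrable (measure_pmf \<mu>) (surprisal \<mu>)"
  obtains l h where "(\<lambda>n. L n / real n) \<longlonglongrightarrow> l" "(\<lambda>n. shannon (W n) / real n) \<longlonglongrightarrow> h"
    "A (l / sqrt (measure_pmf.expectation \<mu> (\<lambda>x. (len x)\<^sup>2))) + 2 * \<bar>ln \<rho>\<bar> \<le> h"
proof -
  obtain l where l: "(\<lambda>n. L n / real n) \<longlonglongrightarrow> l" "\<And>n. l * real n \<le> L n"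
    by (rule fekete[of L, OF L_nonneg L_add_le], rule that)
  obtain h where h: "(\<lambda>n. shannon (W n) / real n) \<longlonglongrightarrow> h"
    and bound: "\<And>\<epsilon>. 0 < \<epsilon> \<Longrightarrow> \<exists>C. \<forall>n. shannon (W n) \<le> C + (h + \<epsilon>) * real n"
    by (rule fekete[of "\<lambda>n. shannon (W n)", OF shannon_nonneg shannon_W_add_le[OF ent]], rule that)
  have l_nonneg: "0 \<le> l"
    by (rule LIMSEQ_le_const[OF l(1)]) (auto intro: exI[of _ 0] simp: len_nonneg)
  let ?lhs = "A (l / sqrt (measure_pmf.expectation \<mu> (\<lambda>x. (len x)\<^sup>2))) + 2 * \<bar>ln \<rho>\<bar>"
  have "?lhs \<le> h + \<epsilon>" if \<epsilon>: "0 < \<epsilon>" for \<epsilon>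
  proof -
    obtain C where C: "\<And>n. shannon (W n) \<le> C + (h + \<epsilon>) * real n"
      using bound[OF \<epsilon>] by blast
    have le: "?lhs \<le> p / (1 - p) * (C - ln p) + (h + \<epsilon>) - ln (1 - p)" if "0 < p" "p < 1" for p
      using resolvent_inequality[OF that l_nonneg l(2) shannon_resolvent_le(1)[OF that ent C]]
        shannon_resolvent_le(2)[OF that ent C] by linarith
    have "((\<lambda>p. p / (1 - p) * (C - ln p) + (h + \<epsilon>) - ln (1 - p)) \<longlongrightarrow> h + \<epsilon>) (at_right 0)"
      by real_asymp
    moreover have "\<forall>\<^sub>F p in at_right (0::real). p < 1"
      by (rule eventually_at_rightI[of 0 1]) auto
    then have "\<forall>\<^sub>F p in at_right 0. ?lhs \<le> p / (1 - p) * (C - ln p) + (h + \<epsilon>) - ln (1 - p)"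
      using eventually_at_right_less[of "0::real"] by eventually_elim (rule le)
    ultimately show ?thesis
      by (rule tendsto_lowerbound) simp
  qed
  then have "?lhs \<le> h" by (rule field_le_epsilon)
  with l(1) h show ?thesis by (rule that)
qed

end

theorem corollary4p1:
  fixes G :: "('a, 'b) monoid_scheme" (structure)
    and d :: "'a \<Rightarrow> 'a \<Rightarrow> real"
    and \<mu> :: "'a pmf"
  assumes "group G"
    and "countable (carrier G)"
    and "Metric_space (carrier G) d"
    and "proper_distance G d"
    and "left_invariant G d"
    and "set_pmf \<mu> \<subseteq> carrier G"
    and "\<mu> \<noteq> return_pmf \<one>"
    and "symmetric_pmf G \<mu>"
    and "finite_second_moment G d \<mu>"
    and "finite_entropy G \<mu>"
  shows "A (drift G d \<mu> / M2 G d \<mu>) + 2 * \<bar>ln (spectral_radius_pmf G \<mu>)\<bar>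
           \<le> asymptotic_entropy G \<mu>"
proof -
  interpret group G by fact
  interpret d: Metric_space "carrier G" d by fact
  have d_left: "d (g \<otimes> x) (g \<otimes> y) = d x y" if "g \<in> carrier G" "x \<in> carrier G" "y \<in> carrier G" for g x y
    using \<open>left_invariant G d\<close> that by (simp add: left_invariant_def)
  let ?len = "\<lambda>g. d g \<one>"
  interpret length_walk G \<mu> ?len
  proof unfold_locales
    show "set_pmf \<mu> \<subseteq> carrier G" "symmetric_pmf G \<mu>" by fact+
    show "0 \<le> ?len g" for g by simp
    show "?len \<one> = 0" by simp
    fix g x assume g: "g \<in> carrier G"
    show "?len (inv g) = ?len g"
      using d_left[of g "inv g" \<one>] g by (simp add: d.commute)
    assume x: "x \<in> carrier G"
    show "?len (g \<otimes> x) \<le> ?len g + ?len x"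
      using d.triangle[of "g \<otimes> x" g \<one>] d_left[of g x \<one>] g x by simp
  next
    show "integrable (measure_pmf \<mu>) (\<lambda>x. (?len x)\<^sup>2)"
      using \<open>finite_second_moment G d \<mu>\<close> \<open>set_pmf \<mu> \<subseteq> carrier G\<close>
      by (intro integrable_pmf_if_summable_on[of _ "carrier G"])
         (simp_all add: finite_second_moment_def mult.commute)
  qed
  have ent: "integrable (measure_pmf \<mu>) (surprisal \<mu>)"
  proof -
    have "integrable (measure_pmf \<mu>) (\<lambda>g. ln (pmf \<mu> g))"
      using \<open>finite_entropy G \<mu>\<close> set_step
      by (intro integrable_pmf_if_summable_on[of _ "carrier G"]) (simp_all add: finite_entropy_def)
    then show ?thesis by (simp add: surprisal_def[abs_def])
  qed
  have M2: "M2 G d \<mu> = sqrt (measure_pmf.expectation \<mu> (\<lambda>x. (?len x)\<^sup>2))"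
    using infsumI[OF has_sum_expectation[OF set_step second_moment]]
    by (simp add: M2_def mult.commute)
  have L: "(\<Sum>\<^sub>\<infinity>g\<in>carrier G. d g \<one> * pmf (W n) g) = L n" for n
    using infsumI[OF has_sum_expectation[OF set_W integrable_len_W]] by (simp add: mult.commute)
  have H: "entropy_pmf G (W n) = shannon (W n)" for n
    using infsumI[OF has_sum_expectation[OF set_W integrable_surprisal_W[OF ent]], of n]
    by (simp add: entropy_pmf_def surprisal_def infsum_uminus)
  obtain l h where l: "(\<lambda>n. L n / real n) \<longlonglongrightarrow> l" and h: "(\<lambda>n. shannon (W n) / real n) \<longlonglongrightarrow> h"
    and le: "A (l / sqrt (measure_pmf.expectation \<mu> (\<lambda>x. (?len x)\<^sup>2))) + 2 * \<bar>ln \<rho>\<bar> \<le> h"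
    by (rule drift_spectral_radius_entropy[OF ent])
  have "drift G d \<mu> = l" unfolding drift_def L by (rule limI[OF l])
  moreover have "asymptotic_entropy G \<mu> = h" unfolding asymptotic_entropy_def H by (rule limI[OF h])
  ultimately show ?thesis using le by (simp only: M2)
qed

end
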